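(* Let $r,n$ be positive integers and $h\in\{0,1,\dots,r-1\}$. Let $k,b$ be integers with $1\le k\le n-1$, $k+1\le b\le n$ and $b\equiv n\pmod 2$, and let $U,V$ be the words (all entries of color $0$) $$U=(b-k,b-k+1,\dots,b-1),\qquad V=(b-k+1,b-k+2,\dots,b).$$ Then the following identities of polynomials in $q$ hold. (i) If $k$ is odd, then $$\sum_{\pi\in G_{r,n}(U)}\chi_{-1,h}(\pi)q^{\mathrm{fmaj}(\pi)}+\sum_{\pi\in G_{r,n}(V)}\chi_{-1,h}(\pi)q^{\mathrm{fmaj}(\pi)}$$ is equal to $$2\,[k+1]_{-q^r}\prod_{i=k+2}^{n}[ir]_{(-1)^{i-1}\zeta^h q}\quad\text{if } n \text{ is even},$$ and to $$2\,[k+1]_{-q^r}[k+2]_{q^r}[r]_{\zeta^h q}\prod_{i=k+3}^{n}[ir]_{(-1)^{i-1}\zeta^h q}\quad\text{if } n \text{ is odd}.$$ (ii) If $k$ is even, then $$\sum_{\pi\in G_{r,n}(U)\setminus G_{r,n}(V)}\chi_{-1,h}(\pi)q^{\mathrm{fmaj}(\pi)}+\sum_{\pi\in G_{r,n}(V)\setminus G_{r,n}(U)}\chi_{-1,h}(\pi)q^{\mathrm{fmaj}(\pi)}$$ is equal to $$2\,[k+1]_{-q^r}\big([r]_{\zeta^h q}-1\big)\prod_{i=k+2}^{n}[ir]_{(-1)^{i-1}\zeta^h q}\quad\text{if } n \text{ is odd},$$ and to $$2 f(r;q)\,[k+1]_{q^r}[k+2]_{-q^r}\prod_{i=k+3}^{n}[ir]_{(-1)^{i-1}\zeta^h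 q}\quad\text{if } n \text{ is even},$$ where $f(r;q)=-(\zeta^h q)\,[r-1]_{(-1)^r\zeta^h q}\,[r]_{(-1)^{r-1}\zeta^h q}$.
   Context: Here $q$ is an indeterminate, $\zeta\in\mathbb{C}$ is a fixed primitive $r$th root of unity, and $[m]_x:=1+x+\cdots+x^{m-1}$ for an integer $m\ge 0$ (so $[0]_x=0$). Empty products equal $1$. $G_{r,n}=\mathbb{Z}_r\wr S_n$ is the group of colored permutations: its elements are $\pi=(\pi_1,\dots,\pi_n)=(\sigma_1^{z_1},\dots,\sigma_n^{z_n})$ with $\sigma=(\sigma_1,\dots,\sigma_n)\in S_n$ (one-line notation) and colors $z_i\in\{0,\dots,r-1\}$. Write $|\pi|=\sigma$ and $\mathrm{col}(\pi)=z_1+\cdots+z_n$ (sum of integers). A colored integer of color $0$ is written without exponent. For $\sigma\in S_n$, $\mathrm{inv}(\sigma)=\#\{i<j:\sigma_i>\sigma_j\}$. The one-dimensional character $\chi_{\epsilon,h}$ ($\epsilon\in\{1,-1\}$) is $\chi_{\epsilon,h}(\pi)=\epsilon^{\mathrm{inv}(|\pi|)}\zeta^{h\cdot\mathrm{col}(\pi)}$. Colored integers are compared in the linear order $$1^{r-1}<\cdots<n^{r-1}<\cdots<1^1<\cdots<n^1<1<\cdots<n.$$ With this order, $\mathrm{maj}_F(\pi)=\sum_{1\le i\le n-1,\ \pi_i>\pi_{i+1}}i$ and $\mathrm{fmaj}(\pi)=r\cdot\mathrm{maj}_F(\pi)+\mathrm{col}(\pi)$. For a word $W$ of colored integers with distinct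 absolute values in $\{1,\dots,n\}$, $G_{r,n}(W)$ is the set of $\pi\in G_{r,n}$ whose word $(\pi_1,\dots,\pi_n)$ contains $W$ (with its colors) as a (not necessarily contiguous) subsequence. *)

theory Defs
  imports
    Complex_Main
    "HOL-Library.Sublist"
    "HOL-Combinatorics.Multiset_Permutations"
    "HOL-Computational_Algebra.Polynomial"
begin

definition primitive_root_of_unity :: "nat \<Rightarrow> complex \<Rightarrow> bool" where
  "primitive_root_of_unity r \<zeta> \<longleftrightarrow> 0 < r \<and> \<zeta> ^ r = 1 \<and> (\<forall>j. 0 < j \<and> j < r \<longrightarrow> \<zeta> ^ j \<noteq> 1)"

text \<open>The bracket \<open>[m]\<^sub>x = 1 + x + \<cdots> + x\<^sup>m\<^sup>-\<^sup>1\<close>.\<close>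

definition qbracket :: "nat \<Rightarrow> 'a::comm_semiring_1 \<Rightarrow> 'a" where
  "qbracket m x = (\<Sum>i<m. x ^ i)"

text \<open>The pair \<open>(a, z)\<close> stands for the colored integer \<open>a\<^sup>z\<close> of absolute value \<open>a\<close> and color \<open>z\<close>.\<close>

type_synonym colored_int = "nat \<times> nat"

text \<open>
  The order \<open>1\<^sup>r\<^sup>-\<^sup>1 < \<cdots> < n\<^sup>r\<^sup>-\<^sup>1 < \<cdots> < 1\<^sup>1 < \<cdots> < n\<^sup>1 < 1 < \<cdots> < n\<close>: larger colors come first, and
  equal colors are compared by absolute value.
\<close>

definition colored_less :: "colored_int \<Rightarrow> colored_int \<Rightarrow> bool" where
  "colored_less x y \<longleftrightarrow> snd y < snd x \<or> snd x = snd y \<and> fst x < fst y"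

text \<open>
  A colored permutation in \<open>G\<^sub>r\<^sub>,\<^sub>n\<close> is represented by its word \<open>(\<pi>\<^sub>1, \<dots>, \<pi>\<^sub>n)\<close>. Lists are indexed
  from \<open>0\<close>, so \<open>\<pi>\<^sub>i\<close> is the list entry \<open>\<pi> ! (i - 1)\<close>.
\<close>

definition colored_perms :: "nat \<Rightarrow> nat \<Rightarrow> colored_int list set" where
  "colored_perms r n =
     {\<pi>. map fst \<pi> \<in> permutations_of_set {1..n} \<and> (\<forall>x\<in>set \<pi>. snd x < r)}"

definition colored_perms_containing ::
    "nat \<Rightarrow> nat \<Rightarrow> colored_int list \<Rightarrow> colored_int list set" where
  "colored_perms_containing r n W = {\<pi> \<in> colored_perms r n. subseq W \<pi>}"

definition abs_perm :: "colored_int list \<Rightarrow> nat list" where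
  "abs_perm \<pi> = map fst \<pi>"

definition col :: "colored_int list \<Rightarrow> nat" where
  "col \<pi> = sum_list (map snd \<pi>)"

definition inversion_number :: "nat list \<Rightarrow> nat" where
  "inversion_number \<sigma> = card {(i, j). i < j \<and> j < length \<sigma> \<and> \<sigma> ! i > \<sigma> ! j}"

definition majF :: "colored_int list \<Rightarrow> nat" where
  "majF \<pi> = (\<Sum>i\<in>{i. 1 \<le> i \<and> i < length \<pi> \<and> colored_less (\<pi> ! i) (\<pi> ! (i - 1))}. i)"

definition fmaj :: "nat \<Rightarrow> colored_int list \<Rightarrow> nat" where
  "fmaj r \<pi> = r * majF \<pi> + col \<pi>"

definition char_1dim :: "complex \<Rightarrow> complex \<Rightarrow> nat \<Rightarrow> colored_int list \<Rightarrow> complex" where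
  "char_1dim \<zeta> \<epsilon> h \<pi> = \<epsilon> ^ inversion_number (abs_perm \<pi>) * \<zeta> ^ (h * col \<pi>)"

definition uncolored :: "nat list \<Rightarrow> colored_int list" where
  "uncolored xs = map (\<lambda>a. (a, 0)) xs"

abbreviation q_var :: "complex poly" where
  "q_var \<equiv> [:0, 1:]"

definition fmaj_sum :: "nat \<Rightarrow> (colored_int list \<Rightarrow> complex) \<Rightarrow> colored_int list set \<Rightarrow> complex poly" where
  "fmaj_sum r \<chi> A = (\<Sum>\<pi>\<in>A. smult (\<chi> \<pi>) (q_var ^ fmaj r \<pi>))"

definition f_factor :: "complex \<Rightarrow> nat \<Rightarrow> nat \<Rightarrow> complex poly" where
  "f_factor \<zeta> h r =
     - smult (\<zeta> ^ h) q_var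
       * qbracket (r - 1) (smult ((-1) ^ r * \<zeta> ^ h) q_var)
       * qbracket r (smult ((-1) ^ (r - 1) * \<zeta> ^ h) q_var)"

lemma finite_colored_perms: "finite (colored_perms r n)"
proof (rule finite_subset)
  show "colored_perms r n \<subseteq> {\<pi>. set \<pi> \<subseteq> {1..n} \<times> {..<r} \<and> length \<pi> = n}"
  proof
    fix \<pi> assume "\<pi> \<in> colored_perms r n"
    then have *: "fst ` set \<pi> = {1..n}" "distinct (map fst \<pi>)" "\<forall>x\<in>set \<pi>. snd x < r"
      by (auto simp: colored_perms_def permutations_of_set_def simp flip: set_map)
    have "length \<pi> = n"
      using distinct_card[OF *(2)] *(1) by simp
    with * show "\<pi> \<in> {\<pi>. set \<pi> \<subseteq> {1..n} \<times> {..<r} \<and> length \<pi> = n}"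
      by force
  qed
qed (rule finite_lists_length_eq, simp)

end

theory Submission
  imports Defs
begin

text \<open>
  Put \<open>t = \<zeta>\<^sup>h q\<close> and \<open>T = t\<^sup>r = q\<^sup>r\<close>; then every sum is a sum of \<open>(-1)\<^bsup>inv\<^esup> t\<^bsup>fmaj\<^esup>\<close>. Exchanging the absolute
  values \<open>a\<close> and \<open>a + 1\<close> flips the sign and preserves \<open>fmaj\<close> unless the two letters are adjacent and of
  equal color. Hence, in the sum over all insertions of these two letters into a word of length \<open>m\<close>, only
  adjacent pairs of equal color survive, and they contribute the factor
  \<open>(1 - T\<^bsup>m+1\<^esup>) (1 - T\<^bsup>m+2\<^esup>) / (1 - t\<^sup>2)\<close>, which is a product of two consecutive brackets of the tail.

  With \<open>p = b - k\<close>, a word containing \<open>U\<close> restricts on the block \<open>{p..b}\<close> to \<open>U\<close> with \<open>b\<close> inserted in some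
  color, and one containing \<open>V\<close> to \<open>V\<close> with \<open>p\<close> inserted. Cyclic relabellings of the block preserve \<open>fmaj\<close>
  and match the two kinds: with sign \<open>(-1)\<^sup>k\<close> if the inserted letter has nonzero color, and with sign
  \<open>(-1)\<^bsup>k+1\<^esup>\<close> if it has color zero and the block is not increasing. So only the words with \<open>p\<close> of color
  zero (\<open>k\<close> odd) or of nonzero color (\<open>k\<close> even) remain, each counted twice. The letters outside the block
  are then removed in pairs; if \<open>p\<close> is even, the remaining letter \<open>p - 1\<close> is paired with \<open>p\<close>.
\<close>

section \<open>Inversions and the major index\<close>

lemma inversion_number_Nil [simp]: "inversion_number [] = 0"
  by (simp add: inversion_number_def)

lemma inversion_number_Cons:
  "inversion_number (x # xs) = length (filter (\<lambda>y. y < x) xs) + inversion_number xs"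
proof -
  let ?I = "{(i, j). i < j \<and> j < length xs \<and> xs ! i > xs ! j}"
  let ?J = "{j. j < length xs \<and> xs ! j < x}"
  have eq: "{(i, j). i < j \<and> j < length (x # xs) \<and> (x # xs) ! i > (x # xs) ! j}
      = (\<lambda>j. (0, Suc j)) ` ?J \<union> map_prod Suc Suc ` ?I" (is "?L = ?R")
  proof (rule set_eqI, clarify)
    fix i j
    show "(i, j) \<in> ?L \<longleftrightarrow> (i, j) \<in> ?R"
      by (cases i; cases j) (auto simp: image_iff)
  qed
  have "finite ?I"
    by (rule finite_subset[of _ "{..<length xs} \<times> {..<length xs}"]) auto
  then have "card ?L = card ?J + card ?I"
    unfolding eq by (subst card_Un_disjoint) (auto simp: card_image inj_on_def)
  then show ?thesis
    by (simp add: inversion_number_def length_filter_conv_card)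
qed

lemma inversion_number_insert:
  "inversion_number (A @ x # C) = inversion_number (A @ C)
     + length (filter (\<lambda>y. x < y) A) + length (filter (\<lambda>y. y < x) C)"
  by (induction A) (auto simp: inversion_number_Cons)

lemma inversion_number_sorted: "sorted xs \<Longrightarrow> inversion_number xs = 0"
proof (induction xs)
  case (Cons x xs)
  then have "filter (\<lambda>y. y < x) xs = []" by (auto simp: filter_empty_conv)
  with Cons show ?case by (simp add: inversion_number_Cons)
qed simp

text \<open>Every letter of \<open>B\<close> compares alike with \<open>a\<close> and
  \<open>Suc a\<close>, and the letters of \<open>A\<close> and \<open>C\<close> meet both values on
  the same side in either order, so only the pair itself adds an inversion.\<close>

lemma inversion_number_swap_Suc:
  assumes "a \<notin> set B" "Suc a \<notin> set B"
  shows "inversion_number (A @ Suc a # B @ a # C) = Suc (inversion_number (A @ a # B @ Suc a # C))"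
proof -
  have 1: "filter (\<lambda>y. y < Suc a) B = filter (\<lambda>y. y < a) B"
    "filter (\<lambda>y. a < y) B = filter (\<lambda>y. Suc a < y) B"
    using assms by (auto intro!: filter_cong simp: less_Suc_eq) (metis Suc_lessI)
  show ?thesis
    using inversion_number_insert[of "A @ B" "a" C] inversion_number_insert[of "A @ B" "Suc a" C]
    by (simp add: inversion_number_insert 1)
qed

text \<open>Each remaining letter forms inversions with both of \<open>a\<close> and
  \<open>Suc a\<close> or with neither, and the ascending pair itself forms none.\<close>

lemma even_inversion_number_insert_pair:
  assumes "a \<notin> set A" "Suc a \<notin> set A" "a \<notin> set C" "Suc a \<notin> set C"
  shows "even (inversion_number (A @ a # Suc a # C) + inversion_number (A @ C))"
proof -
  have 1: "filter (\<lambda>y. y < Suc a) C = filter (\<lambda>y. y < a) C"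
    "filter (\<lambda>y. a < y) A = filter (\<lambda>y. Suc a < y) A"
    using assms by (auto intro!: filter_cong simp: less_Suc_eq) (metis Suc_lessI)
  have "inversion_number (A @ a # Suc a # C) = inversion_number (A @ C)
      + 2 * (length (filter (\<lambda>y. Suc a < y) A) + length (filter (\<lambda>y. y < a) C))"
    by (simp add: inversion_number_insert 1)
  then show ?thesis by simp
qed

lemma sign_transpose_Suc:
  assumes "distinct xs" "a \<in> set xs" "Suc a \<in> set xs"
  shows "(-1 :: 'a::comm_ring_1) ^ inversion_number (map (transpose a (Suc a)) xs)
           = - ((-1) ^ inversion_number xs)"
proof -
  obtain A D where xs: "xs = A @ a # D" using assms(2) by (meson split_list)
  have id: "map (transpose a (Suc a)) L = L" if "a \<notin> set L" "Suc a \<notin> set L" for L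
    using that by (intro map_idI) (auto simp: transpose_def)
  show ?thesis
  proof (cases "Suc a \<in> set A")
    case True
    then obtain P Q where A: "A = P @ Suc a # Q" by (meson split_list)
    have "inversion_number (P @ Suc a # Q @ a # D) = Suc (inversion_number (P @ a # Q @ Suc a # D))"
      by (rule inversion_number_swap_Suc) (use assms(1) xs A in auto)
    moreover have "map (transpose a (Suc a)) xs = P @ a # Q @ Suc a # D"
      using assms(1) xs A by (auto simp: id)
    ultimately show ?thesis using xs A by simp
  next
    case False
    then obtain P Q where D: "D = P @ Suc a # Q" using assms(3) xs by (auto dest: split_list)
    have "inversion_number (A @ Suc a # P @ a # Q) = Suc (inversion_number (A @ a # P @ Suc a # Q))"
      by (rule inversion_number_swap_Suc) (use assms(1) xs D in auto)
    moreover have "map (transpose a (Suc a)) xs = A @ Suc a # P @ a # Q"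
      using assms(1) xs D by (auto simp: id)
    ultimately show ?thesis using xs D by simp
  qed
qed

text \<open>The cycle p -> p + 1 -> ... -> q -> p on values. For \<open>p = q\<close> it is the
  identity, which starts the inductions on \<open>q\<close>.\<close>

definition cyc :: "nat \<Rightarrow> nat \<Rightarrow> nat \<Rightarrow> nat" where
  "cyc p q v = (if p \<le> v \<and> v < q then Suc v else if v = q then p else v)"

lemma cyc_Suc: "p \<le> q \<Longrightarrow> cyc p (Suc q) = cyc p q \<circ> transpose q (Suc q)"
  by (auto simp: fun_eq_iff cyc_def transpose_def)

lemma bij_cyc: "p \<le> q \<Longrightarrow> bij (cyc p q)"
proof (induction q rule: dec_induct)
  case base
  have "cyc p p = id" by (auto simp: fun_eq_iff cyc_def)
  then show ?case by (metis bij_id)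
next
  case (step q)
  then show ?case unfolding cyc_Suc[OF step.hyps(1)] by (intro bij_comp) auto
qed

text \<open>The cycle is a product of \<open>q - p\<close> exchanges of consecutive values, and each
  of them flips the sign as long as both values occur in the word.\<close>

lemma sign_cyc:
  assumes "p \<le> q" "distinct xs" "{p..q} \<subseteq> set xs"
  shows "(-1 :: 'a::comm_ring_1) ^ inversion_number (map (cyc p q) xs)
           = (-1) ^ (q - p) * (-1) ^ inversion_number xs"
  using assms
proof (induction q arbitrary: xs rule: dec_induct)
  case base
  have "cyc p p = id" by (auto simp: fun_eq_iff cyc_def)
  then show ?case by simp
next
  case (step q)
  \<comment> \<open>The exchange of \<open>q\<close> and \<open>Suc q\<close> acts first; the
    exchanged word still contains \<open>{p..q}\<close>, so the induction hypothesis applies to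
    it.\<close>
  let ?ys = "map (transpose q (Suc q)) xs"
  have "{p..q} \<subseteq> set ?ys"
  proof
    fix v assume v: "v \<in> {p..q}"
    then have "transpose q (Suc q) v \<in> set xs"
      using step.prems(2) step.hyps by (auto simp: transpose_def)
    then have "transpose q (Suc q) (transpose q (Suc q) v) \<in> set ?ys"
      unfolding set_map by (rule imageI)
    then show "v \<in> set ?ys" by simp
  qed
  moreover have "distinct ?ys"
    using step.prems by (simp add: distinct_map)
  ultimately have IH: "(-1 :: 'a) ^ inversion_number (map (cyc p q) ?ys)
      = (-1) ^ (q - p) * (-1) ^ inversion_number ?ys"
    by (rule step.IH[rotated])
  have "q \<in> set xs" "Suc q \<in> set xs" using step.prems(2) step.hyps by auto
  then have "(-1 :: 'a) ^ inversion_number ?ys = - ((-1) ^ inversion_number xs)"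
    using step.prems(1) by (intro sign_transpose_Suc)
  with IH step.hyps show ?case
    by (simp add: cyc_Suc Suc_diff_le comp_def)
qed

section \<open>The major index under appending and exchanging letters\<close>

lemma majF_Nil [simp]: "majF [] = 0"
  by (simp add: majF_def)

lemma majF_singleton [simp]: "majF [x] = 0"
  by (simp add: majF_def)

text \<open>A new last letter leaves all positions fixed and can only add the descent at
  \<open>length w\<close>; this is why the inductions on \<open>majF\<close> run from the
  right.\<close>

lemma majF_snoc:
  "majF (w @ [y]) = majF w + (if w \<noteq> [] \<and> colored_less y (last w) then length w else 0)"
proof (cases "w = []")
  case False
  let ?D = "\<lambda>w. {i. 1 \<le> i \<and> i < length w \<and> colored_less (w ! i) (w ! (i - 1))}"
  have "?D (w @ [y]) = ?D w \<union> (if colored_less y (last w) then {length w} else {})"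
    using False by (auto simp: nth_append less_Suc_eq last_conv_nth)
  moreover have "finite (?D w)" by simp
  ultimately show ?thesis
    using False by (simp add: majF_def)
qed simp

lemma majF_append_two:
  "majF (w @ [x, y]) = majF (w @ [x]) + (if colored_less y x then Suc (length w) else 0)"
  using majF_snoc[of "w @ [x]" y] by simp

lemma col_append [simp]: "col (u @ v) = col u + col v"
  by (simp add: col_def)

lemma col_Cons [simp]: "col (x # v) = snd x + col v"
  by (simp add: col_def)

lemma col_Nil [simp]: "col [] = 0"
  by (simp add: col_def)

text \<open>The neighbours on both sides cannot tell \<open>x\<close> from \<open>x'\<close>, so the
  two words differ only in the descent inside the pair, at position
  \<open>Suc (length A)\<close>.\<close>

lemma majF_swap_adjacent:
  assumes x: "colored_less x x'" "\<not> colored_less x' x"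
    and A: "\<And>y. y \<in> set A \<Longrightarrow> colored_less x y \<longleftrightarrow> colored_less x' y"
    and C: "\<And>y. y \<in> set C \<Longrightarrow> colored_less y x \<longleftrightarrow> colored_less y x'"
  shows "majF (A @ x' # x # C) = majF (A @ x # x' # C) + Suc (length A)"
  using C
proof (induction C rule: rev_induct)
  case Nil
  show ?case
    using x A[of "last A"] majF_snoc[of "[x]" x'] majF_snoc[of "[x']" x] by (cases "A = []") (auto simp: majF_append_two majF_snoc)
next
  case (snoc y C)
  then have IH: "majF (A @ x' # x # C) = majF (A @ x # x' # C) + Suc (length A)" by simp
  show ?case
    using IH majF_snoc[of "A @ x' # x # C" y] majF_snoc[of "A @ x # x' # C" y] snoc.prems[of y]
    by (cases "C = []") auto
qed

section \<open>Words and relabelling\<close>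

text \<open>An arbitrary set \<open>S\<close> of absolute values replaces \<open>{1..n}\<close>, so
  that letters can be removed without renumbering the rest.\<close>

definition words :: "nat \<Rightarrow> nat set \<Rightarrow> colored_int list set" where
  "words r S = {w. distinct (map fst w) \<and> fst ` set w = S \<and> (\<forall>x\<in>set w. snd x < r)}"

text \<open>For t = \<zeta>^h q this is the summand of the theorem: \<open>fmaj\<close> and
  \<open>col\<close> agree modulo \<open>r\<close>, so the power of \<open>t\<close> absorbs the
  color part of the character.\<close>

definition weight :: "nat \<Rightarrow> 'a::comm_ring_1 \<Rightarrow> colored_int list \<Rightarrow> 'a" where
  "weight r t w = (-1) ^ inversion_number (map fst w) * t ^ fmaj r w"

definition letters_in :: "nat set \<Rightarrow> colored_int list \<Rightarrow> colored_int list" where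
  "letters_in S w = filter (\<lambda>x. fst x \<in> S) w"

lemma colored_perms_eq_words: "colored_perms r n = words r {1..n}"
  by (auto simp: colored_perms_def words_def permutations_of_set_def)

lemma length_words: "w \<in> words r S \<Longrightarrow> length w = card S"
  by (auto simp: words_def dest: distinct_card)

lemma words_memD:
  assumes "w \<in> words r S" "x \<in> set w"
  shows "fst x \<in> S" "snd x < r"
proof -
  have "fst x \<in> fst ` set w" by (rule imageI) (rule assms(2))
  with assms show "fst x \<in> S" "snd x < r" by (simp_all add: words_def)
qed

lemma words_notin: "w \<in> words r S \<Longrightarrow> a \<notin> S \<Longrightarrow> x \<in> set w \<Longrightarrow> fst x \<noteq> a"
  using words_memD(1) by blast

lemma finite_words:
  assumes "finite S"
  shows "finite (words r S)"
proof (rule finite_subset)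
  show "words r S \<subseteq> {w. set w \<subseteq> S \<times> {..<r} \<and> length w = card S}"
  proof clarify
    fix w assume w: "w \<in> words r S"
    then have "set w \<subseteq> S \<times> {..<r}" by (auto dest: words_memD)
    with length_words[OF w] show "set w \<subseteq> S \<times> {..<r} \<and> length w = card S" by simp
  qed
  show "finite {w. set w \<subseteq> S \<times> {..<r} \<and> length w = card S}"
    using assms by (intro finite_lists_length_eq) simp
qed

lemma letters_in_words: "w \<in> words r S \<Longrightarrow> letters_in S0 w \<in> words r (S \<inter> S0)"
  by (auto simp: words_def letters_in_def distinct_map_filter)

lemma letters_in_letters_in: "letters_in S (letters_in S' w) = letters_in (S' \<inter> S) w"
  by (simp add: letters_in_def Int_def)

definition relabel :: "(nat \<Rightarrow> nat) \<Rightarrow> colored_int list \<Rightarrow> colored_int list" where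
  "relabel f = map (apfst f)"

lemma col_relabel [simp]: "col (relabel f w) = col w"
  by (simp add: col_def relabel_def comp_def)

lemma map_fst_relabel [simp]: "map fst (relabel f w) = map f (map fst w)"
  by (simp add: relabel_def)

lemma length_relabel [simp]: "length (relabel f w) = length w"
  by (simp add: relabel_def)

lemma relabel_in_words:
  assumes "w \<in> words r S" "bij_betw f S S'"
  shows "relabel f w \<in> words r S'"
proof -
  have S: "set (map fst w) = S" using assms(1) by (simp add: words_def)
  then have "distinct (map f (map fst w))"
    using assms by (simp only: distinct_map) (auto simp: words_def bij_betw_def distinct_map)
  then have "distinct (map fst (relabel f w))" by simp
  moreover have "fst ` set (relabel f w) = S'"
    unfolding set_map[symmetric] map_fst_relabel
    using S assms(2) by (simp only: set_map) (simp add: bij_betw_def)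
  moreover have "\<forall>x\<in>set (relabel f w). snd x < r"
    using assms(1) by (auto simp: relabel_def words_def)
  ultimately show ?thesis by (simp add: words_def)
qed

lemma relabel_relabel_id:
  assumes "\<And>x. x \<in> set w \<Longrightarrow> g (f (fst x)) = fst x"
  shows "relabel g (relabel f w) = w"
  using assms by (auto simp: relabel_def intro!: map_idI)

lemma letters_in_relabel:
  assumes "\<And>x. x \<in> set w \<Longrightarrow> f (fst x) \<in> S0 \<longleftrightarrow> fst x \<in> S0"
  shows "letters_in S0 (relabel f w) = relabel f (letters_in S0 w)"
  using assms by (simp add: letters_in_def relabel_def filter_map comp_def cong: filter_cong)

lemma relabel_id:
  assumes "\<And>x. x \<in> set w \<Longrightarrow> f (fst x) = fst x"
  shows "relabel f w = w"
  using assms by (auto simp: relabel_def intro!: map_idI)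

section \<open>Relabellings and the flag major index\<close>

lemma majF_map:
  assumes "\<And>A x y C. w = A @ x # y # C \<Longrightarrow>
    colored_less (g y) (g x) \<longleftrightarrow> colored_less y x"
  shows "majF (map g w) = majF w"
proof -
  have "colored_less (map g w ! i) (map g w ! (i - 1)) \<longleftrightarrow> colored_less (w ! i) (w ! (i - 1))"
    if "1 \<le> i" "i < length w" for i
  proof -
    define j where "j = i - 1"
    have j: "i = Suc j" using that(1) by (simp add: j_def)
    have "w = take j w @ w ! j # w ! Suc j # drop (Suc (Suc j)) w"
      using that j by (simp add: Cons_nth_drop_Suc)
    from assms[OF this] show ?thesis
      using that j by simp
  qed
  then have "{i. 1 \<le> i \<and> i < length w \<and> colored_less (map g w ! i) (map g w ! (i - 1))}
      = {i. 1 \<le> i \<and> i < length w \<and> colored_less (w ! i) (w ! (i - 1))}" by blast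
  then show ?thesis by (simp add: majF_def)
qed

lemma fmaj_relabel:
  assumes "\<And>A x y C. w = A @ x # y # C \<Longrightarrow>
    colored_less (apfst f y) (apfst f x) \<longleftrightarrow> colored_less y x"
  shows "fmaj r (relabel f w) = fmaj r w"
proof -
  have "majF (relabel f w) = majF w"
    unfolding relabel_def by (rule majF_map) (rule assms)
  then show ?thesis by (simp add: fmaj_def)
qed

text \<open>All other letters compare alike with the values \<open>a\<close> and
  \<open>Suc a\<close>. A descent could therefore change only where the two letters are neighbours,
  and there unequal colors decide. Thus \<open>fmaj\<close> is kept while the sign flips.\<close>

lemma weight_transpose_Suc:
  assumes w: "w \<in> words r S" "(a, y) \<in> set w" "(Suc a, z) \<in> set w"
    and adj: "y \<noteq> z \<or> (\<nexists>A C. w = A @ (a, y) # (Suc a, z) # C \<or> w = A @ (Suc a, z) # (a, y) # C)"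
  shows "weight r t (relabel (transpose a (Suc a)) w) = - weight r t w"
proof -
  have dist: "distinct (map fst w)" using w by (simp add: words_def)
  have uniq: "x = (a, y)" if "x \<in> set w" "fst x = a" for x
    using eq_key_imp_eq_value[OF dist] that w(2) by (cases x) auto
  have uniq': "x = (Suc a, z)" if "x \<in> set w" "fst x = Suc a" for x
    using eq_key_imp_eq_value[OF dist] that w(3) by (cases x) auto
  have "fmaj r (relabel (transpose a (Suc a)) w) = fmaj r w"
  proof (rule fmaj_relabel)
    fix A x x' C assume eq: "w = A @ x # x' # C"
    then have mem: "x \<in> set w" "x' \<in> set w" by auto
    have ne: "fst x \<noteq> fst x'" using dist eq by auto
    show "colored_less (apfst (transpose a (Suc a)) x') (apfst (transpose a (Suc a)) x)
        \<longleftrightarrow> colored_less x' x"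
    proof (cases "{fst x, fst x'} = {a, Suc a}")
      case True
      then have "x = (a, y) \<and> x' = (Suc a, z) \<or> x = (Suc a, z) \<and> x' = (a, y)"
        using mem uniq uniq' by (metis doubleton_eq_iff)
      moreover have "y \<noteq> z" if "x = (a, y) \<and> x' = (Suc a, z) \<or> x = (Suc a, z) \<and> x' = (a, y)"
        using that adj eq by blast
      ultimately have "snd x \<noteq> snd x'" by auto
      then show ?thesis by (simp add: colored_less_def)
    next
      case False
      then show ?thesis using ne by (auto simp: colored_less_def transpose_def)
    qed
  qed
  moreover have "(-1 :: 'a) ^ inversion_number (map (transpose a (Suc a)) (map fst w))
      = - ((-1) ^ inversion_number (map fst w))"
    using w dist by (intro sign_transpose_Suc) force+
  ultimately show ?thesis by (simp add: weight_def del: map_map)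
qed

text \<open>The summand at \<open>p\<close> is the contribution of the two adjacent insertions \<open>x x'\<close> and \<open>x' x\<close> after
  the first \<open>p\<close> letters: they have opposite signs, and the descending one has an extra descent at \<open>p + 1\<close>.\<close>

lemma sum_insert_pair:
  fixes T :: "'a::comm_ring_1"
  assumes xx': "colored_less x x'" "\<not> colored_less x' x"
    and cmp: "\<And>y. y \<in> set w \<Longrightarrow> colored_less x y \<longleftrightarrow> colored_less x' y"
      "\<And>y. y \<in> set w \<Longrightarrow> colored_less y x \<longleftrightarrow> colored_less y x'"
      "\<And>y. y \<in> set w \<Longrightarrow> fst y \<noteq> fst x"
    and dist: "distinct (map fst w)"
  defines "m \<equiv> length w"
  shows "(\<Sum>p\<le>m. T ^ majF (take p w @ x # x' # drop p w) * (1 - T ^ Suc p)) * (1 - T ^ 2)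
           = T ^ majF w * (1 - T ^ (m + 1)) * (1 - T ^ (m + 2))"
  unfolding m_def using cmp dist
proof (induction w rule: rev_induct)
  case Nil
  then show ?case using xx' majF_append_two[of "[]" x x'] by (simp add: power2_eq_square)
next
  case (snoc y w)
  define m where "m = length w"
  define F where "F = (\<Sum>p\<le>m. T ^ majF (take p w @ x # x' # drop p w) * (1 - T ^ Suc p))"
  have IH: "F * (1 - T ^ 2) = T ^ majF w * (1 - T ^ (m + 1)) * (1 - T ^ (m + 2))"
    unfolding F_def m_def by (rule snoc.IH) (use snoc.prems in auto)
  have F: "F = (\<Sum>p<m. T ^ majF (take p w @ x # x' # drop p w) * (1 - T ^ Suc p))
      + T ^ majF (w @ [x, x']) * (1 - T ^ Suc m)"
    unfolding F_def by (simp add: m_def lessThan_Suc_atMost[symmetric])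
  \<comment> \<open>Indicators of three descents: \<open>y\<close> after \<open>w\<close>,
    \<open>x\<close> after \<open>w\<close>, and \<open>x\<close> after \<open>y\<close>. They
    determine all major indices that arise when \<open>y\<close> is appended.\<close>
  define e where "e = (if w \<noteq> [] \<and> colored_less y (last w) then 1 else 0 :: nat)"
  define g where "g = (if w \<noteq> [] \<and> colored_less x (last w) then 1 else 0 :: nat)"
  define h where "h = (if colored_less x y then 1 else 0 :: nat)"
  have y: "fst y \<noteq> fst x" "colored_less x y \<longleftrightarrow> colored_less x' y" "colored_less y x \<longleftrightarrow> colored_less y x'"
    using snoc.prems by auto
  have tot: "colored_less y x \<longleftrightarrow> \<not> colored_less x y"
    using y(1) by (auto simp: colored_less_def)
  \<comment> \<open>For \<open>p < m\<close> the word still ends in \<open>last w\<close>, now at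
    position \<open>m + 2\<close>, so \<open>y\<close> adds a descent there exactly when
    \<open>e = 1\<close>. The pair directly before \<open>y\<close> and the pair directly after it
    are treated in \<open>mid\<close> and \<open>top\<close>.\<close>
  have low: "majF (take p (w @ [y]) @ x # x' # drop p (w @ [y]))
      = majF (take p w @ x # x' # drop p w) + e * (m + 2)" if "p < m" for p
    using that majF_snoc[of "take p w @ x # x' # drop p w" y]
    by (auto simp: e_def m_def)
  have mid: "majF (w @ [x, x', y]) = majF w + g * m + (1 - h) * (m + 2)"
    using majF_snoc[of "w @ [x, x']" y] xx' y tot
    by (auto simp: majF_append_two majF_snoc g_def h_def m_def)
  have last: "majF (w @ [x, x']) = majF w + g * m"
    using xx' by (auto simp: majF_append_two majF_snoc g_def m_def)
  have top: "majF (w @ [y, x, x']) = majF w + e * m + h * (m + 1)"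
    using majF_append_two[of "w @ [y]" x x'] majF_append_two[of w y x] xx'
    by (auto simp: majF_snoc h_def m_def e_def)
  have wy: "majF (w @ [y]) = majF w + e * m"
    by (auto simp: majF_snoc e_def m_def)
  have "(\<Sum>p\<le>length (w @ [y]). T ^ majF (take p (w @ [y]) @ x # x' # drop p (w @ [y])) * (1 - T ^ Suc p))
     = (\<Sum>p<m. T ^ (majF (take p w @ x # x' # drop p w) + e * (m + 2)) * (1 - T ^ Suc p))
      + T ^ majF (w @ [x, x', y]) * (1 - T ^ Suc m) + T ^ majF (w @ [y, x, x']) * (1 - T ^ Suc (Suc m))"
    using low by (simp add: m_def[symmetric] lessThan_Suc_atMost[symmetric])
  also have "(\<Sum>p<m. T ^ (majF (take p w @ x # x' # drop p w) + e * (m + 2)) * (1 - T ^ Suc p))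
     = T ^ (e * (m + 2)) * (F - T ^ majF (w @ [x, x']) * (1 - T ^ Suc m))"
    unfolding F by (simp add: sum_distrib_left power_add algebra_simps)
  finally have tot: "(\<Sum>p\<le>length (w @ [y]). T ^ majF (take p (w @ [y]) @ x # x' # drop p (w @ [y])) * (1 - T ^ Suc p))
     = T ^ (e * (m + 2)) * (F - T ^ majF (w @ [x, x']) * (1 - T ^ Suc m))
      + T ^ majF (w @ [x, x', y]) * (1 - T ^ Suc m) + T ^ majF (w @ [y, x, x']) * (1 - T ^ Suc (Suc m))" .
  have S: "(\<Sum>p\<le>length (w @ [y]). T ^ majF (take p (w @ [y]) @ x # x' # drop p (w @ [y])) * (1 - T ^ Suc p)) * (1 - T ^ 2)
     = T ^ (e * (m + 2)) * (F * (1 - T ^ 2)) + (1 - T ^ 2) *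
       (T ^ majF (w @ [x, x', y]) * (1 - T ^ Suc m) + T ^ majF (w @ [y, x, x']) * (1 - T ^ Suc (Suc m))
        - T ^ (e * (m + 2)) * T ^ majF (w @ [x, x']) * (1 - T ^ Suc m))"
    unfolding tot by (simp add: algebra_simps)
  have cases: "(e = 0 \<or> e = 1) \<and> (g = 0 \<or> g = 1) \<and> (h = 0 \<or> h = 1)"
    by (simp add: e_def g_def h_def)
  have ends: "fst (last w) \<noteq> fst y" "fst (last w) \<noteq> fst x" if "w \<noteq> []"
  proof -
    have l: "last w \<in> set w" using that by simp
    then show "fst (last w) \<noteq> fst x" using snoc.prems(3)[of "last w"] by simp
    have "fst (last w) \<in> fst ` set w" using l by (rule imageI)
    moreover have "fst y \<notin> fst ` set w" using snoc.prems(4) by simp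
    ultimately show "fst (last w) \<noteq> fst y" by metis
  qed
  \<comment> \<open>Transitivity of the order excludes two patterns, x < last w < y < x and y < last
    w < x < y. The remaining values of \<open>e\<close>, \<open>g\<close>, \<open>h\<close> are
    checked one by one.\<close>
  have consistent: "m = 0 \<or> \<not> (e = 0 \<and> g = 1 \<and> h = 0) \<and> \<not> (e = 1 \<and> g = 0 \<and> h = 1)"
    using ends by (auto simp: e_def g_def h_def m_def colored_less_def split: if_splits)
  have len: "length (w @ [y]) = Suc m" by (simp add: m_def)
  show ?case
  proof (cases "m = 0")
    case True
    then have "w = []" by (simp add: m_def)
    then have "e = 0" "g = 0" by (simp_all add: e_def g_def)
    then show ?thesis
      unfolding S unfolding IH wy mid last top len using cases True
      by (elim conjE disjE) (simp_all add: algebra_simps power_add power2_eq_square)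
  next
    case False
    with consistent have c: "\<not> (e = 0 \<and> g = 1 \<and> h = 0)" "\<not> (e = 1 \<and> g = 0 \<and> h = 1)" by auto
    show ?thesis
      unfolding S unfolding IH wy mid last top len using cases c
      by (elim conjE disjE) (simp_all add: algebra_simps power_add power2_eq_square)
  qed
qed

lemma set_relabel: "set (relabel f w) = apfst f ` set w"
  by (simp add: relabel_def)

lemma relabel_append [simp]: "relabel f (u @ v) = relabel f u @ relabel f v"
  by (simp add: relabel_def)

lemma relabel_Cons [simp]: "relabel f (x # v) = apfst f x # relabel f v"
  by (simp add: relabel_def)

section \<open>Inserting two letters with consecutive absolute values\<close>

definition pair_insertions ::
    "nat \<Rightarrow> nat set \<Rightarrow> nat \<Rightarrow> nat \<Rightarrow> nat \<Rightarrow> colored_int list \<Rightarrow> colored_int list set" where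
  "pair_insertions r S a y z w = {w' \<in> words r (insert a (insert (Suc a) S)).
     letters_in S w' = w \<and> (a, y) \<in> set w' \<and> (Suc a, z) \<in> set w'}"

lemma relabel_transpose_transpose [simp]:
  "relabel (transpose a b) (relabel (transpose a b) w) = w"
  by (rule relabel_relabel_id) simp

lemma finite_pair_insertions: "finite S \<Longrightarrow> finite (pair_insertions r S a y z w)"
  by (simp add: pair_insertions_def finite_words)

lemma transpose_pair_insertions:
  assumes "w' \<in> pair_insertions r S a y z w" "a \<notin> S" "Suc a \<notin> S"
  shows "relabel (transpose a (Suc a)) w' \<in> pair_insertions r S a z y w"
proof -
  let ?f = "transpose a (Suc a)"
  have w': "w' \<in> words r (insert a (insert (Suc a) S))" "letters_in S w' = w"
    "(a, y) \<in> set w'" "(Suc a, z) \<in> set w'"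
    using assms(1) by (auto simp: pair_insertions_def)
  have S: "?f v \<in> S \<longleftrightarrow> v \<in> S" "v \<in> S \<Longrightarrow> ?f v = v" for v
    using assms(2,3) by (auto simp: transpose_def)
  have "bij_betw ?f (insert a (insert (Suc a) S)) (insert a (insert (Suc a) S))"
    by (rule bij_betwI[where g = ?f]) (auto simp: transpose_def)
  with w'(1) have "relabel ?f w' \<in> words r (insert a (insert (Suc a) S))"
    by (rule relabel_in_words)
  moreover have "letters_in S (relabel ?f w') = w"
    using w'(2) by (subst letters_in_relabel) (auto simp: S letters_in_def intro!: relabel_id)
  moreover have "apfst ?f (Suc a, z) \<in> set (relabel ?f w')" "apfst ?f (a, y) \<in> set (relabel ?f w')"
    unfolding set_relabel by (rule imageI, fact)+
  ultimately show ?thesis by (simp add: pair_insertions_def)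
qed

text \<open>Unequal colors rule out the exceptional adjacent pairs, so exchanging the two absolute
  values is a sign-reversing bijection between the two sets of words.\<close>

lemma sum_pair_insertions_antisym:
  assumes "a \<notin> S" "Suc a \<notin> S" "y \<noteq> z"
  shows "sum (weight r t) (pair_insertions r S a y z w) = - sum (weight r t) (pair_insertions r S a z y w)"
  unfolding sum_negf[symmetric]
proof (rule sum.reindex_bij_witness[of _ "relabel (transpose a (Suc a))" "relabel (transpose a (Suc a))"])
  fix w' assume w': "w' \<in> pair_insertions r S a y z w"
  then have "weight r t (relabel (transpose a (Suc a)) w') = - weight r t w'"
    using assms(3) by (intro weight_transpose_Suc) (auto simp: pair_insertions_def)
  then show "- weight r t (relabel (transpose a (Suc a)) w') = weight r t w'" by simp
qed (use assms in \<open>auto intro: transpose_pair_insertions\<close>)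

lemma colored_less_Suc:
  assumes "fst y \<noteq> a" "fst y \<noteq> Suc a"
  shows "colored_less (a, z) y \<longleftrightarrow> colored_less (Suc a, z) y"
    and "colored_less y (a, z) \<longleftrightarrow> colored_less y (Suc a, z)"
  using assms by (auto simp: colored_less_def)

text \<open>The ascending insertion has the sign of \<open>w\<close> and the descending one the
  opposite sign; the extra descent at \<open>Suc p\<close> of the latter gives the second term of
  the difference.\<close>

lemma weight_insert_adjacent_pair:
  assumes w: "w \<in> words r S" "a \<notin> S" "Suc a \<notin> S" and p: "p \<le> length w"
  shows "weight r t (take p w @ (a, z) # (Suc a, z) # drop p w)
      + weight r t (take p w @ (Suc a, z) # (a, z) # drop p w)
    = (-1) ^ inversion_number (map fst w) * t ^ (col w + 2 * z)
      * ((t ^ r) ^ majF (take p w @ (a, z) # (Suc a, z) # drop p w) * (1 - (t ^ r) ^ Suc p))"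
proof -
  let ?A = "take p w" and ?C = "drop p w"
  have fst: "fst y \<noteq> a" "fst y \<noteq> Suc a" if "y \<in> set w" for y
    using that words_notin[OF w(1)] w(2,3) by blast+
  have fst': "y \<in> fst ` set w \<Longrightarrow> y \<noteq> a \<and> y \<noteq> Suc a" for y by (metis fst imageE)
  have AC: "set ?A \<subseteq> set w" "set ?C \<subseteq> set w"
    by (auto dest: in_set_takeD in_set_dropD)
  have m: "majF (?A @ (Suc a, z) # (a, z) # ?C) = majF (?A @ (a, z) # (Suc a, z) # ?C) + Suc p"
  proof -
    have "majF (?A @ (Suc a, z) # (a, z) # ?C) = majF (?A @ (a, z) # (Suc a, z) # ?C) + Suc (length ?A)"
    proof (rule majF_swap_adjacent)
      fix y assume "y \<in> set ?A"
      then have "y \<in> set w" by (rule in_set_takeD)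
      then show "colored_less (a, z) y \<longleftrightarrow> colored_less (Suc a, z) y"
        by (intro colored_less_Suc fst)
    next
      fix y assume "y \<in> set ?C"
      then have "y \<in> set w" by (rule in_set_dropD)
      then show "colored_less y (a, z) \<longleftrightarrow> colored_less y (Suc a, z)"
        by (intro colored_less_Suc fst)
    qed (simp_all add: colored_less_def)
    with p show ?thesis by simp
  qed
  have c: "col ?A + col ?C = col w"
    unfolding col_append[symmetric] by simp
  let ?i = "inversion_number (map fst ?A @ a # Suc a # map fst ?C)"
  have "even (?i + inversion_number (map fst ?A @ map fst ?C))"
    by (rule even_inversion_number_insert_pair) (use AC fst' in \<open>auto dest: fst\<close>)
  then have s: "(-1 :: 'a) ^ ?i = (-1) ^ inversion_number (map fst w)"
    by (simp flip: map_append) (auto simp: uminus_power_if)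
  have "inversion_number (map fst ?A @ Suc a # a # map fst ?C) = Suc ?i"
    using inversion_number_swap_Suc[of a "[]" "map fst ?A" "map fst ?C"] by simp
  then show ?thesis
    unfolding mult_2
    by (simp add: weight_def fmaj_def m s c[symmetric] power_add power_mult[symmetric] algebra_simps)
qed

text \<open>Deleting the adjacent pair leaves \<open>w\<close>, so such a word is given by the order
  of the pair and the number \<open>p\<close> of letters of \<open>w\<close> in front of it.\<close>

lemma adjacent_pair_insertions:
  assumes w: "w \<in> words r S" "a \<notin> S" "Suc a \<notin> S" "z < r"
  defines "Asc \<equiv> (\<lambda>p. take p w @ (a, z) # (Suc a, z) # drop p w)"
      and "Desc \<equiv> (\<lambda>p. take p w @ (Suc a, z) # (a, z) # drop p w)"
  shows "{w' \<in> pair_insertions r S a z z w.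
       \<exists>A C. w' = A @ (a, z) # (Suc a, z) # C \<or> w' = A @ (Suc a, z) # (a, z) # C}
     = Asc ` {..length w} \<union> Desc ` {..length w}" (is "?L = ?R")
proof (rule set_eqI, rule iffI)
  have S: "fst ` set w = S" "distinct (map fst w)" using w(1) by (auto simp: words_def)
  have wS: "letters_in S w = w" using w(1) by (auto simp: letters_in_def intro!: filter_True dest: words_memD)
  fix w'
  {
    assume "w' \<in> ?L"
    then obtain A C where *: "w' \<in> pair_insertions r S a z z w"
      "w' = A @ (a, z) # (Suc a, z) # C \<or> w' = A @ (Suc a, z) # (a, z) # C" by blast
    then have d: "distinct (map fst w')" and T: "w' \<in> words r (insert a (insert (Suc a) S))"
      and lw: "letters_in S w' = w"
      by (auto simp: pair_insertions_def words_def)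
    have sub: "fst x \<in> S" if "x \<in> set A \<union> set C" for x
    proof -
      have "x \<in> set w'" using that *(2) by auto
      then have "fst x \<in> insert a (insert (Suc a) S)" using words_memD(1)[OF T] by blast
      moreover have "fst x \<noteq> a" "fst x \<noteq> Suc a" using d that *(2) by (auto simp: image_iff) metis+
      ultimately show ?thesis by simp
    qed
    then have "filter (\<lambda>x. fst x \<in> S) A = A" "filter (\<lambda>x. fst x \<in> S) C = C"
      by (auto intro!: filter_True)
    with lw *(2) w(2,3) have "w = A @ C" by (auto simp: letters_in_def)
    then have "length A \<le> length w" "take (length A) w = A" "drop (length A) w = C" by auto
    with *(2) have "w' = Asc (length A) \<or> w' = Desc (length A)" by (auto simp: Asc_def Desc_def)
    with \<open>length A \<le> length w\<close> show "w' \<in> ?R" by auto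
  }
  {
    assume "w' \<in> ?R"
    then obtain p where p: "w' = Asc p \<or> w' = Desc p" by auto
    define A C where "A = take p w" and "C = drop p w"
    have AC: "w = A @ C" by (simp add: A_def C_def)
    have p': "w' = A @ (a, z) # (Suc a, z) # C \<or> w' = A @ (Suc a, z) # (a, z) # C"
      using p by (auto simp: A_def C_def Asc_def Desc_def)
    have "set w' = insert (a, z) (insert (Suc a, z) (set w))" using p' AC by auto
    moreover have "distinct (map fst w')"
      using p' AC S w(2,3) by auto
    ultimately have "w' \<in> words r (insert a (insert (Suc a) S))"
      using w(1,4) by (auto simp: words_def)
    moreover have "letters_in S w' = w"
      using p' wS w(2,3) AC by (auto simp: letters_in_def)
    ultimately show "w' \<in> ?L"
      using p' by (auto simp: pair_insertions_def)
  }
qed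

text \<open>Words in which the two letters are not neighbours cancel under the exchange; the others
  are listed by position and summed with \<open>sum_insert_pair\<close>. The factor
  \<open>1 - (t ^ r) ^ 2\<close> stays on the left to avoid a division.\<close>

lemma sum_pair_insertions_diag:
  fixes t :: "'a::{idom,ring_char_0}"
  assumes w: "w \<in> words r S" "a \<notin> S" "Suc a \<notin> S" "z < r" and fin: "finite S"
  shows "sum (weight r t) (pair_insertions r S a z z w) * (1 - (t ^ r) ^ 2)
    = weight r t w * t ^ (2 * z) * (1 - (t ^ r) ^ (length w + 1)) * (1 - (t ^ r) ^ (length w + 2))"
proof -
  define Asc where "Asc = (\<lambda>p. take p w @ (a, z) # (Suc a, z) # drop p w)"
  define Desc where "Desc = (\<lambda>p. take p w @ (Suc a, z) # (a, z) # drop p w)"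
  define E where "E = pair_insertions r S a z z w"
  define adj where "adj = (\<lambda>w'. \<exists>A C. w' = A @ (a, z) # (Suc a, z) # C \<or> w' = A @ (Suc a, z) # (a, z) # C)"
  let ?R = "relabel (transpose a (Suc a))"
  have finE: "finite E" unfolding E_def using fin by (rule finite_pair_insertions)
  have fst: "fst y \<noteq> a" "fst y \<noteq> Suc a" if "y \<in> set w" for y
    using that words_notin[OF w(1)] w(2,3) by blast+
  have nin: "(a, z) \<notin> set (take p w)" "(Suc a, z) \<notin> set (take p w)"
    "(a, z) \<notin> set (drop p w)" "(Suc a, z) \<notin> set (drop p w)" for p
    using fst by (force dest: in_set_takeD in_set_dropD)+
  have adjR: "adj (?R w')" if "adj w'" for w'
    using that unfolding adj_def by (elim exE disjE; simp; blast)
  have "sum (weight r t) {w' \<in> E. \<not> adj w'} = (\<Sum>w' \<in> {w' \<in> E. \<not> adj w'}. - weight r t w')"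
  proof (rule sum.reindex_bij_witness[of _ ?R ?R])
    fix w' assume w': "w' \<in> {w' \<in> E. \<not> adj w'}"
    then show "?R (?R w') = w'" "?R (?R w') = w'" by simp_all
    have "\<not> adj (?R w')" using w' adjR[of "?R w'"] by auto
    with w' show "?R w' \<in> {w' \<in> E. \<not> adj w'}" "?R w' \<in> {w' \<in> E. \<not> adj w'}"
      using w(2,3) by (auto simp: E_def transpose_pair_insertions)
    have "weight r t (?R w') = - weight r t w'"
      using w' by (intro weight_transpose_Suc[where y = z and z = z])
        (auto simp: E_def pair_insertions_def adj_def)
    then show "- weight r t (?R w') = weight r t w'" by simp
  qed
  \<comment> \<open>The exchange only shows that the sum equals its own negative; cancelling 2 uses
    characteristic zero.\<close>
  then have "2 * sum (weight r t) {w' \<in> E. \<not> adj w'} = 0"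
    unfolding sum_negf by (simp only: mult_2 eq_neg_iff_add_eq_0)
  then have zero: "sum (weight r t) {w' \<in> E. \<not> adj w'} = 0" by simp
  have Asc_inj: "inj_on Asc {..length w}"
  proof (rule inj_onI)
    fix p q assume pq: "p \<in> {..length w}" "q \<in> {..length w}" "Asc p = Asc q"
    then have "take p w = take q w"
      by (simp add: Asc_def append_Cons_eq_iff nin)
    then have "length (take p w) = length (take q w)" by simp
    with pq show "p = q" by simp
  qed
  have Desc_inj: "inj_on Desc {..length w}"
  proof (rule inj_onI)
    fix p q assume pq: "p \<in> {..length w}" "q \<in> {..length w}" "Desc p = Desc q"
    then have "take p w = take q w"
      by (simp add: Desc_def append_Cons_eq_iff nin)
    then have "length (take p w) = length (take q w)" by simp
    with pq show "p = q" by simp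
  qed
  have disj: "Asc ` {..length w} \<inter> Desc ` {..length w} = {}"
  proof -
    have False if "Asc p = Desc q" for p q
    proof -
      have "take p w @ (a, z) # (Suc a, z) # drop p w
          = (take q w @ [(Suc a, z)]) @ (a, z) # drop q w"
        using that by (simp add: Asc_def Desc_def)
      then have "take p w = take q w @ [(Suc a, z)]"
        by (subst (asm) append_Cons_eq_iff) (auto simp: nin)
      then have "(Suc a, z) \<in> set (take p w)" by simp
      with nin show False by blast
    qed
    then show ?thesis by blast
  qed
  have "sum (weight r t) E = sum (weight r t) {w' \<in> E. adj w'} + sum (weight r t) {w' \<in> E. \<not> adj w'}"
    by (subst sum.union_disjoint[symmetric]) (use finE in \<open>auto intro: sum.cong\<close>)
  also have "\<dots> = sum (weight r t) (Asc ` {..length w} \<union> Desc ` {..length w})"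
    using adjacent_pair_insertions[OF w] zero by (simp add: E_def adj_def Asc_def Desc_def)
  also have "\<dots> = (\<Sum>p\<le>length w. weight r t (Asc p)) + (\<Sum>p\<le>length w. weight r t (Desc p))"
    by (subst sum.union_disjoint) (use disj Asc_inj Desc_inj in \<open>auto simp: sum.reindex\<close>)
  also have "\<dots> = (\<Sum>p\<le>length w. weight r t (Asc p) + weight r t (Desc p))"
    by (simp add: sum.distrib)
  also have "\<dots> = (-1) ^ inversion_number (map fst w) * t ^ (col w + 2 * z) *
      (\<Sum>p\<le>length w. (t ^ r) ^ majF (Asc p) * (1 - (t ^ r) ^ Suc p))"
    unfolding sum_distrib_left Asc_def Desc_def
    using w by (intro sum.cong refl weight_insert_adjacent_pair) auto
  finally have "sum (weight r t) E * (1 - (t ^ r) ^ 2)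
      = (-1) ^ inversion_number (map fst w) * t ^ (col w + 2 * z) *
      ((\<Sum>p\<le>length w. (t ^ r) ^ majF (Asc p) * (1 - (t ^ r) ^ Suc p)) * (1 - (t ^ r) ^ 2))"
    by (simp only: mult.assoc)
  also have "(\<Sum>p\<le>length w. (t ^ r) ^ majF (Asc p) * (1 - (t ^ r) ^ Suc p)) * (1 - (t ^ r) ^ 2)
      = (t ^ r) ^ majF w * (1 - (t ^ r) ^ (length w + 1)) * (1 - (t ^ r) ^ (length w + 2))"
    unfolding Asc_def
  proof (rule sum_insert_pair)
    show "distinct (map fst w)" using w by (simp add: words_def)
    fix y assume "y \<in> set w"
    from fst[OF this] show "colored_less (a, z) y \<longleftrightarrow> colored_less (Suc a, z) y"
      "colored_less y (a, z) \<longleftrightarrow> colored_less y (Suc a, z)" "fst y \<noteq> fst (a, z)"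
      by (auto simp: colored_less_def)
  qed (simp_all add: colored_less_def)
  finally show ?thesis
    unfolding E_def by (simp add: weight_def fmaj_def power_add power_mult[symmetric] algebra_simps)
qed

section \<open>Sums over words with a prescribed restriction\<close>

lemma qbracket_mult_one_minus: "qbracket m x * (1 - x) = 1 - (x :: 'a::comm_ring_1) ^ m"
  by (simp add: qbracket_def one_diff_power_eq mult.commute)

definition wsum :: "nat \<Rightarrow> 'a::comm_ring_1 \<Rightarrow> nat set \<Rightarrow> nat set \<Rightarrow> colored_int list set \<Rightarrow> 'a" where
  "wsum r t S S0 B = sum (weight r t) {w \<in> words r S. letters_in S0 w \<in> B}"

lemma wsum_image:
  assumes "finite S" "finite I" "inj_on f I"
  shows "wsum r t S S0 (f ` I) = (\<Sum>i\<in>I. wsum r t S S0 {f i})"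
proof -
  have "{w \<in> words r S. letters_in S0 w \<in> f ` I} = (\<Union>i\<in>I. {w \<in> words r S. letters_in S0 w \<in> {f i}})"
    by auto
  then show ?thesis
    unfolding wsum_def using assms
    by (simp only:) (rule sum.UNION_disjoint, auto simp: finite_words inj_on_def)
qed

lemma letters_in_superset: "w \<in> words r S \<Longrightarrow> S \<subseteq> S0 \<Longrightarrow> letters_in S0 w = w"
  unfolding letters_in_def by (rule filter_True) (auto dest: words_memD)

lemma letters_in_eq_self: "w \<in> words r S \<Longrightarrow> letters_in S w = w"
  by (rule letters_in_superset[OF _ subset_refl])

lemma wsum_self:
  assumes "u \<in> words r S"
  shows "wsum r t S S {u} = weight r t u"
proof -
  have "{w \<in> words r S. letters_in S w \<in> {u}} = {u}"
    using assms letters_in_eq_self by auto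
  then show ?thesis by (simp add: wsum_def)
qed

text \<open>The off-diagonal part is its own negative when the two indices are exchanged, hence zero
  in characteristic zero.\<close>

lemma sum_antisymmetric:
  fixes H :: "nat \<Rightarrow> nat \<Rightarrow> 'a::{idom,ring_char_0}"
  assumes "\<And>y z. y \<noteq> z \<Longrightarrow> H y z = - H z y"
  shows "(\<Sum>y<r. \<Sum>z<r. H y z) = (\<Sum>z<r. H z z)"
proof -
  define N where "N = (\<Sum>y<r. \<Sum>z<r. if y = z then 0 else H y z)"
  have "N = (\<Sum>z<r. \<Sum>y<r. if y = z then 0 else H y z)"
    unfolding N_def by (rule sum.swap)
  also have "\<dots> = - N"
    unfolding N_def sum_negf[symmetric]
  proof (intro sum.cong refl)
    fix y z show "(if z = y then 0 else H z y) = - (if y = z then 0 else H y z)"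
      using assms[of z y] by auto
  qed
  finally have "2 * N = 0" by (simp only: mult_2 eq_neg_iff_add_eq_0)
  then have "N = 0" by simp
  have "(\<Sum>y<r. \<Sum>z<r. H y z)
      = (\<Sum>y<r. \<Sum>z<r. (if y = z then 0 else H y z) + (if y = z then H y y else 0))"
    by (intro sum.cong refl) auto
  also have "\<dots> = N + (\<Sum>y<r. H y y)"
    unfolding N_def by (simp add: sum.distrib)
  finally show ?thesis using \<open>N = 0\<close> by simp
qed

section \<open>Inserting one letter into a word\<close>

definition inserted :: "nat \<Rightarrow> nat \<Rightarrow> nat \<Rightarrow> colored_int list \<Rightarrow> colored_int list" where
  "inserted c z j U = take j U @ (c, z) # drop j U"

lemma length_inserted [simp]: "length (inserted c z j U) = Suc (length U)"
  by (simp add: inserted_def)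

lemma nth_inserted:
  assumes "j \<le> length U" "i \<le> length U"
  shows "inserted c z j U ! i = (if i < j then U ! i else if i = j then (c, z) else U ! (i - 1))"
  using assms by (auto simp: inserted_def nth_append nth_Cons' min_def)

lemma set_inserted: "set (inserted c z j U) = insert (c, z) (set U)"
proof -
  have "set (take j U) \<union> set (drop j U) = set U" by (simp flip: set_append)
  then show ?thesis unfolding inserted_def by (auto simp only: set_append set_simps)
qed

lemma inserted_in_words:
  assumes "U \<in> words r S" "c \<notin> S" "z < r"
  shows "inserted c z j U \<in> words r (insert c S)"
proof -
  have U: "distinct (map fst U)" "fst ` set U = S" using assms(1) by (auto simp: words_def)
  have "distinct (map fst (take j U @ drop j U))" using U by simp
  moreover have "c \<notin> fst ` set (take j U @ drop j U)" using U assms(2) by simp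
  ultimately have "distinct (map fst (inserted c z j U))"
    unfolding inserted_def map_append set_append image_Un distinct_append by auto
  then show ?thesis
    using assms U by (auto simp: words_def set_inserted)
qed

lemma subseq_inserted: "subseq U (inserted c z j U)"
proof -
  have "subseq (take j U @ drop j U) (inserted c z j U)"
    unfolding inserted_def by (intro list_emb_append_mono list_emb_Cons) auto
  then show ?thesis by simp
qed

lemma letters_in_inserted:
  assumes "U \<in> words r S" "c \<notin> S"
  shows "letters_in S (inserted c z j U) = U"
proof -
  have "letters_in S (inserted c z j U) = letters_in S (take j U @ drop j U)"
    using assms by (simp add: letters_in_def inserted_def del: append_take_drop_id)
  then show ?thesis using letters_in_eq_self[OF assms(1)] by simp
qed

text \<open>Deleting \<open>c\<close> from \<open>u\<close> leaves a word of the same length as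
  \<open>U\<close> that still has \<open>U\<close> as a subsequence, hence \<open>U\<close>
  itself.\<close>

lemma subseq_imp_inserted:
  assumes u: "u \<in> words r (insert c S)" and U: "U \<in> words r S" "c \<notin> S"
    and sub: "subseq U u" and fin: "finite S"
  shows "\<exists>z<r. \<exists>j\<le>length U. u = inserted c z j U"
proof -
  have "c \<in> fst ` set u" using u by (simp add: words_def)
  then obtain z where z: "(c, z) \<in> set u" by auto
  then obtain A C where AC: "u = A @ (c, z) # C" by (meson split_list)
  have dist: "distinct (map fst u)" using u by (simp add: words_def)
  have nin: "fst x \<noteq> c" if "x \<in> set A \<union> set C" for x
    using that dist AC by auto
  have "subseq (filter (\<lambda>x. fst x \<noteq> c) U) (filter (\<lambda>x. fst x \<noteq> c) u)"
    using sub by (rule subseq_filter)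
  moreover have "filter (\<lambda>x. fst x \<noteq> c) U = U"
    by (rule filter_True) (use words_notin[OF U] in blast)
  moreover have "filter (\<lambda>x. fst x \<noteq> c) A = A" "filter (\<lambda>x. fst x \<noteq> c) C = C"
    using nin by (auto intro!: filter_True)
  ultimately have "subseq U (A @ C)" by (simp add: AC)
  moreover have "length u = Suc (length U)"
    using length_words[OF u] length_words[OF U(1)] U(2) fin by simp
  then have "length U = length (A @ C)" by (simp add: AC)
  ultimately have "U = A @ C" by (rule subseq_same_length)
  then have "u = inserted c z (length A) U" "length A \<le> length U"
    by (simp_all add: inserted_def AC)
  moreover have "z < r" using words_memD(2)[OF u z] by simp
  ultimately show ?thesis by blast
qed

lemma inserted_inj:
  assumes U: "U \<in> words r S" "c \<notin> S"
    and le: "j \<le> length U" "j' \<le> length U" and eq: "inserted c z j U = inserted c z' j' U"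
  shows "z = z' \<and> j = j'"
proof -
  have nin: "(c, x) \<notin> set U" for x
    using words_notin[OF U, of "(c, x)"] by auto
  have "(c, z) \<in> insert (c, z') (set U)"
    using eq set_inserted[of c z j U] set_inserted[of c z' j' U] by auto
  then have z: "z = z'" using nin by auto
  have "(c, z) \<notin> set (take i U)" "(c, z) \<notin> set (drop i U)" for i
    using nin by (auto dest: in_set_takeD in_set_dropD)
  then have "take j U = take j' U"
    using eq z by (simp add: inserted_def append_Cons_eq_iff)
  then have "length (take j U) = length (take j' U)" by simp
  with z le show ?thesis by simp
qed

lemma words_containing:
  assumes U: "U \<in> words r S" "c \<notin> S" and sub: "insert c S \<subseteq> N" and fin: "finite S"
  shows "{w \<in> words r N. subseq U w}
    = {w \<in> words r N. letters_in (insert c S) w \<in> (\<lambda>(z, j). inserted c z j U) ` ({..<r} \<times> {..length U})}"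
proof (rule Collect_cong, rule conj_cong[OF refl])
  fix w assume w: "w \<in> words r N"
  let ?u = "letters_in (insert c S) w"
  have u: "?u \<in> words r (insert c S)"
    using letters_in_words[OF w, of "insert c S"] sub by (simp add: Int_absorb1)
  show "subseq U w \<longleftrightarrow> ?u \<in> (\<lambda>(z, j). inserted c z j U) ` ({..<r} \<times> {..length U})"
  proof
    assume "subseq U w"
    then have "subseq (letters_in (insert c S) U) ?u"
      unfolding letters_in_def by (rule subseq_filter)
    then have "subseq U ?u"
      by (simp only: letters_in_superset[OF U(1) subset_insertI])
    from subseq_imp_inserted[OF u U this fin]
    show "?u \<in> (\<lambda>(z, j). inserted c z j U) ` ({..<r} \<times> {..length U})" by auto
  next
    assume "?u \<in> (\<lambda>(z, j). inserted c z j U) ` ({..<r} \<times> {..length U})"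
    then have "subseq U ?u" using subseq_inserted by auto
    also have "subseq ?u w" by (simp add: letters_in_def)
    finally show "subseq U w" .
  qed
qed

text \<open>\<open>f\<close> permutes an interval and fixes all other values, so comparisons with
  outside letters do not change; those between neighbouring block letters are covered by the
  hypothesis on \<open>u\<close>. Hence \<open>fmaj\<close> is kept and every weight is multiplied
  by \<open>c\<close>.\<close>

lemma wsum_relabel:
  assumes f: "bij f" "\<And>v. f v \<in> {lo..hi} \<longleftrightarrow> v \<in> {lo..hi}" "\<And>v. v \<notin> {lo..hi} \<Longrightarrow> f v = v"
    and sub: "{lo..hi} \<subseteq> S"
    and sign: "\<And>xs. distinct xs \<Longrightarrow> {lo..hi} \<subseteq> set xs \<Longrightarrow>
      (-1 :: 'a::comm_ring_1) ^ inversion_number (map f xs) = c * (-1) ^ inversion_number xs"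
    and u: "\<And>A x y C. u = A @ x # y # C \<Longrightarrow>
      colored_less (apfst f y) (apfst f x) \<longleftrightarrow> colored_less y x"
  shows "wsum r t S {lo..hi} {relabel f u} = c * wsum r t S {lo..hi} {u}"
proof -
  let ?I = "{lo..hi}"
  define g where "g = inv f"
  have gf: "g (f v) = v" "f (g v) = v" for v
    using f(1) unfolding g_def by (simp_all add: bij_is_inj bij_is_surj surj_f_inv_f)
  have g: "g v \<in> ?I \<longleftrightarrow> v \<in> ?I" "v \<notin> ?I \<Longrightarrow> g v = v" for v
    using f(2)[of "g v"] f(3)[of v] gf[of v] by (simp, metis)
  have S: "f v \<in> S \<longleftrightarrow> v \<in> S" "g v \<in> S \<longleftrightarrow> v \<in> S" for v
    using f(2)[of v] f(3)[of v] g[of v] sub by (cases "v \<in> ?I"; auto)+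
  have bS: "bij_betw f S S" "bij_betw g S S"
    by (rule bij_betwI[where g = g]; simp add: gf S)
       (rule bij_betwI[where g = f]; simp add: gf S)
  have weq: "weight r t (relabel f w) = c * weight r t w"
    if w: "w \<in> words r S" "letters_in ?I w = u" for w
  proof -
    have "fmaj r (relabel f w) = fmaj r w"
    proof (rule fmaj_relabel)
      fix A x y C assume eq: "w = A @ x # y # C"
      have ne: "fst x \<noteq> fst y" using w(1) eq by (auto simp: words_def)
      consider "fst x \<in> ?I" "fst y \<in> ?I" | "fst x \<notin> ?I" | "fst x \<in> ?I" "fst y \<notin> ?I" by blast
      then show "colored_less (apfst f y) (apfst f x) \<longleftrightarrow> colored_less y x"
      proof cases
        \<comment> \<open>Neighbouring block letters of \<open>w\<close> are also neighbours in its
          restriction \<open>u\<close>.\<close>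
        case 1
        then have "u = letters_in ?I A @ x # y # letters_in ?I C"
          using w(2) eq by (simp add: letters_in_def)
        then show ?thesis by (rule u)
      next
        case 2
        then have "f (fst x) = fst x" by (rule f(3))
        moreover have "f (fst y) = fst y \<or> fst y \<in> ?I \<and> f (fst y) \<in> ?I" using f(2,3) by blast
        ultimately show ?thesis using 2 by (auto simp: colored_less_def)
      next
        case 3
        then have "f (fst y) = fst y" "f (fst x) \<in> ?I" using f(2,3) by auto
        then show ?thesis using 3 by (auto simp: colored_less_def)
      qed
    qed
    moreover have "(-1 :: 'a) ^ inversion_number (map f (map fst w)) = c * (-1) ^ inversion_number (map fst w)"
      using w(1) sub by (intro sign) (auto simp: words_def)
    ultimately show ?thesis by (simp add: weight_def del: map_map)
  qed
  have LI: "letters_in ?I (relabel f w) = relabel f (letters_in ?I w)"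
    "letters_in ?I (relabel g w) = relabel g (letters_in ?I w)" for w
    using f(2) g(1) by (auto intro!: letters_in_relabel)
  have id: "relabel g (relabel f w) = w" "relabel f (relabel g w) = w" for w
    by (auto intro!: relabel_relabel_id simp: gf)
  show ?thesis
    unfolding wsum_def sum_distrib_left
  proof (rule sum.reindex_bij_witness[of _ "relabel f" "relabel g"])
    fix w assume "w \<in> {w \<in> words r S. letters_in ?I w \<in> {relabel f u}}"
    then have w: "w \<in> words r S" "letters_in ?I w = relabel f u" by auto
    then show *: "relabel g w \<in> {w \<in> words r S. letters_in ?I w \<in> {u}}"
      using bS by (simp add: LI id relabel_in_words)
    from * have "weight r t (relabel f (relabel g w)) = c * weight r t (relabel g w)"
      by (intro weq) auto
    then show "c * weight r t (relabel g w) = weight r t w" by (simp add: id)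
  qed (use bS in \<open>auto simp: LI id relabel_in_words\<close>)
qed

text \<open>The factor with index \<open>i\<close> of the tail products in the theorem, at t =
  \<zeta>^h q.\<close>

definition bracket_factor :: "nat \<Rightarrow> 'a::comm_ring_1 \<Rightarrow> nat \<Rightarrow> 'a" where
  "bracket_factor r t i = qbracket (i * r) ((-1) ^ (i - 1) * t)"

text \<open>Consecutive brackets have arguments \<open>s * t\<close> and \<open>- s * t\<close> with
  \<open>s = (-1) ^ m\<close>, so their denominators multiply to \<open>1 - t ^ 2\<close>. The signs
  in the numerators vanish because m (m + 1) and (m + 1) (m + 2) are even.\<close>

lemma bracket_factor_pair:
  fixes t :: "'a::comm_ring_1"
  shows "bracket_factor r t (m + 1) * bracket_factor r t (m + 2) * (1 - t ^ 2)
    = (1 - (t ^ r) ^ (m + 1)) * (1 - (t ^ r) ^ (m + 2))"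
proof -
  define s where "s = (-1 :: 'a) ^ m"
  have s: "s * s = 1" "s ^ (m + 1) = 1" "(- s) ^ (m + 2) = 1"
    unfolding s_def by (simp_all add: uminus_power_if flip: power_add power_mult)
  have x: "(s * t) ^ ((m + 1) * r) = (t ^ r) ^ (m + 1)" "(- s * t) ^ ((m + 2) * r) = (t ^ r) ^ (m + 2)"
    unfolding power_mult power_mult_distrib s(2,3)
    by (simp_all only: power_mult[symmetric] mult.commute power_one mult_1_left)
  have b: "bracket_factor r t (m + 1) = qbracket ((m + 1) * r) (s * t)"
    "bracket_factor r t (m + 2) = qbracket ((m + 2) * r) (- s * t)"
    by (simp_all add: bracket_factor_def s_def)
  have "bracket_factor r t (m + 1) * bracket_factor r t (m + 2) * ((1 - s * t) * (1 - (- s) * t))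
      = (bracket_factor r t (m + 1) * (1 - s * t)) * (bracket_factor r t (m + 2) * (1 - (- s) * t))"
    by (simp only: mult.assoc mult.left_commute mult.commute)
  also have "\<dots> = (1 - (t ^ r) ^ (m + 1)) * (1 - (t ^ r) ^ (m + 2))"
    unfolding b qbracket_mult_one_minus x ..
  finally have "bracket_factor r t (m + 1) * bracket_factor r t (m + 2) * ((1 - s * t) * (1 - (- s) * t))
      = (1 - (t ^ r) ^ (m + 1)) * (1 - (t ^ r) ^ (m + 2))" .
  also have "(1 - s * t) * (1 - (- s) * t) = 1 - (s * s) * t ^ 2"
    by (simp add: algebra_simps power2_eq_square)
  finally show ?thesis by (simp add: s)
qed

text \<open>The identities are proved after multiplication by factors such as
  \<open>1 - t ^ 2\<close>. Cancelling these asks for an integral domain in which no positive power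
  of \<open>t\<close> is 1, as for the polynomial \<zeta>^h q.\<close>

locale non_torsion =
  fixes r :: nat and t :: "'a::{idom,ring_char_0}"
  assumes r_pos: "1 \<le> r" and non_torsion: "\<And>i. 0 < i \<Longrightarrow> t ^ i \<noteq> 1"
begin

abbreviation T :: 'a where "T \<equiv> t ^ r"

lemma T_ne_1: "0 < i \<Longrightarrow> T ^ i \<noteq> 1"
  using non_torsion[of "r * i"] r_pos by (simp add: power_mult)

lemma one_minus_ne_0: "1 - t ^ 2 \<noteq> 0" "1 - T ^ 2 \<noteq> 0" "1 - t \<noteq> 0" "1 - T \<noteq> 0" "1 + T \<noteq> 0"
proof -
  show "1 - t ^ 2 \<noteq> 0" "1 - T ^ 2 \<noteq> 0" "1 - t \<noteq> 0" "1 - T \<noteq> 0"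
    using non_torsion[of 2] T_ne_1[of 2] non_torsion[of 1] T_ne_1[of 1] by simp_all
  have "(1 - T) * (1 + T) = 1 - T ^ 2" by (simp add: algebra_simps power2_eq_square)
  with \<open>1 - T ^ 2 \<noteq> 0\<close> show "1 + T \<noteq> 0" by auto
qed

text \<open>Sum over the colors of the two new letters: unequal colors cancel by antisymmetry, and
  equal ones leave the geometric sum of \<open>t ^ (2 * z)\<close>, which trades the denominator
  \<open>1 - T ^ 2\<close> for \<open>1 - t ^ 2\<close>.\<close>

lemma wsum_single_pair:
  assumes w: "w \<in> words r S" "a \<notin> S" "Suc a \<notin> S" and fin: "finite S"
  shows "sum (weight r t) {w' \<in> words r (insert a (insert (Suc a) S)). letters_in S w' = w}
    = weight r t w * (bracket_factor r t (card S + 1) * bracket_factor r t (card S + 2))"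
proof -
  define H where "H = (\<lambda>y z. sum (weight r t) (pair_insertions r S a y z w))"
  define m where "m = card S"
  let ?W = "words r (insert a (insert (Suc a) S))"
  have len: "length w = m" using length_words[OF w(1)] by (simp add: m_def)
  have color: "\<exists>y<r. (v, y) \<in> set w'" if "w' \<in> ?W" "v = a \<or> v = Suc a" for w' v
  proof -
    have "v \<in> fst ` set w'" using that by (auto simp: words_def)
    then show ?thesis using words_memD(2)[OF that(1)] by fastforce
  qed
  have uniq: "y = y'" if "w' \<in> ?W" "(v, y) \<in> set w'" "(v, y') \<in> set w'" for w' v y y'
    using that by (auto simp: words_def dest: eq_key_imp_eq_value)
  have U: "{w' \<in> ?W. letters_in S w' = w}
      = (\<Union>(y, z)\<in>{..<r} \<times> {..<r}. pair_insertions r S a y z w)" (is "?L = ?R")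
  proof
    show "?L \<subseteq> ?R"
    proof
      fix w' assume w': "w' \<in> ?L"
      then obtain y z where "y < r" "(a, y) \<in> set w'" "z < r" "(Suc a, z) \<in> set w'"
        using color[of w' a] color[of w' "Suc a"] by auto
      with w' show "w' \<in> ?R" by (auto simp: pair_insertions_def)
    qed
  qed (auto simp: pair_insertions_def)
  have disj: "pair_insertions r S a y z w \<inter> pair_insertions r S a y' z' w = {}"
    if "(y, z) \<noteq> (y', z')" for y z y' z'
    using that uniq by (auto simp: pair_insertions_def)
  have "sum (weight r t) ?L = (\<Sum>(y, z)\<in>{..<r} \<times> {..<r}. H y z)"
    unfolding U H_def using disj
    by (subst sum.UNION_disjoint) (auto simp: fin finite_pair_insertions split_def)
  also have "\<dots> = (\<Sum>y<r. \<Sum>z<r. H y z)"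
    by (simp add: sum.cartesian_product)
  also have "\<dots> = (\<Sum>z<r. H z z)"
    unfolding H_def by (intro sum_antisymmetric sum_pair_insertions_antisym w)
  finally have L: "sum (weight r t) ?L = (\<Sum>z<r. H z z)" .
  have "(\<Sum>z<r. H z z) * (1 - T ^ 2)
      = (\<Sum>z<r. t ^ (2 * z)) * (weight r t w * ((1 - T ^ (m + 1)) * (1 - T ^ (m + 2))))"
    unfolding sum_distrib_right
  proof (intro sum.cong refl)
    fix z assume "z \<in> {..<r}"
    then show "H z z * (1 - T ^ 2) = t ^ (2 * z) * (weight r t w * ((1 - T ^ (m + 1)) * (1 - T ^ (m + 2))))"
      using sum_pair_insertions_diag[OF w, of z t] fin unfolding H_def len
      by (simp add: algebra_simps)
  qed
  then have "(\<Sum>z<r. H z z) * (1 - T ^ 2) * (1 - t ^ 2)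
      = ((\<Sum>z<r. t ^ (2 * z)) * (1 - t ^ 2)) * (weight r t w * ((1 - T ^ (m + 1)) * (1 - T ^ (m + 2))))"
    by (simp add: mult.commute mult.left_commute)
  also have "(\<Sum>z<r. t ^ (2 * z)) * (1 - t ^ 2) = 1 - T ^ 2"
    using qbracket_mult_one_minus[of r "t ^ 2"]
    by (simp add: qbracket_def power_mult[symmetric] mult.commute)
  finally have "(\<Sum>z<r. H z z) * (1 - t ^ 2) * (1 - T ^ 2)
      = weight r t w * (bracket_factor r t (m + 1) * bracket_factor r t (m + 2) * (1 - t ^ 2)) * (1 - T ^ 2)"
    unfolding bracket_factor_pair by (simp only: mult.commute mult.left_commute)
  then show ?thesis
    unfolding L m_def[symmetric] using one_minus_ne_0 by (simp add: mult.assoc[symmetric])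
qed

text \<open>The words are grouped by their restriction to \<open>S\<close>, which determines the
  restriction to \<open>S0\<close>; every group has the same factor.\<close>

lemma wsum_pair:
  assumes S: "a \<notin> S" "Suc a \<notin> S" "finite S" "S0 \<subseteq> S"
  shows "wsum r t (insert a (insert (Suc a) S)) S0 B
    = wsum r t S S0 B * (bracket_factor r t (card S + 1) * bracket_factor r t (card S + 2))"
proof -
  let ?W = "words r (insert a (insert (Suc a) S))"
  let ?D = "{w' \<in> ?W. letters_in S0 w' \<in> B}" and ?E = "{w \<in> words r S. letters_in S0 w \<in> B}"
  have res: "letters_in S0 (letters_in S w') = letters_in S0 w'" for w'
    using S(4) by (simp add: letters_in_letters_in Int_absorb1)
  have "letters_in S w' \<in> words r S" if "w' \<in> ?W" for w'
    using letters_in_words[OF that, of S] S(1,2) by (simp add: Int_absorb2 subset_insertI2 Int_insert_left)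
  then have "sum (weight r t) ?D = (\<Sum>w\<in>?E. sum (weight r t) {w' \<in> ?D. letters_in S w' = w})"
    using S(3) by (intro sum.group[symmetric]) (auto simp: finite_words res)
  also have "\<dots> = (\<Sum>w\<in>?E. weight r t w * (bracket_factor r t (card S + 1) * bracket_factor r t (card S + 2)))"
  proof (rule sum.cong[OF refl])
    fix w assume w: "w \<in> ?E"
    then have "{w' \<in> ?D. letters_in S w' = w} = {w' \<in> ?W. letters_in S w' = w}"
      using res by auto
    then show "sum (weight r t) {w' \<in> ?D. letters_in S w' = w}
        = weight r t w * (bracket_factor r t (card S + 1) * bracket_factor r t (card S + 2))"
      using wsum_single_pair[of w S a] w S by simp
  qed
  finally show ?thesis by (simp add: wsum_def sum_distrib_right)
qed

text \<open>The factor of a pair depends only on the number of letters already present, so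
  successive pairs produce the consecutive indices after \<open>L\<close>.\<close>

lemma wsum_pairs_above:
  assumes "S0 \<subseteq> {lo..<lo + L}"
  shows "wsum r t {lo..<lo + L + 2 * i} S0 B
    = wsum r t {lo..<lo + L} S0 B * (\<Prod>j\<in>{L + 1..L + 2 * i}. bracket_factor r t j)"
proof (induction i)
  case (Suc i)
  let ?a = "lo + L + 2 * i"
  have eq: "{lo..<lo + L + 2 * Suc i} = insert ?a (insert (Suc ?a) {lo..<?a})" by auto
  have "wsum r t {lo..<lo + L + 2 * Suc i} S0 B = wsum r t {lo..<?a} S0 B *
      (bracket_factor r t (card {lo..<?a} + 1) * bracket_factor r t (card {lo..<?a} + 2))"
    unfolding eq using assms by (intro wsum_pair) auto
  also have "card {lo..<?a} = L + 2 * i" by simp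
  finally show ?case unfolding Suc.IH by (simp add: mult.assoc)
qed simp

lemma wsum_pairs_below:
  assumes "S0 \<subseteq> {lo + 2 * i..<lo + 2 * i + L}"
  shows "wsum r t {lo..<lo + 2 * i + L} S0 B
    = wsum r t {lo + 2 * i..<lo + 2 * i + L} S0 B * (\<Prod>j\<in>{L + 1..L + 2 * i}. bracket_factor r t j)"
  using assms
proof (induction i arbitrary: lo)
  case (Suc i)
  \<comment> \<open>The lowest pair is removed first, and the induction continues with
    \<open>lo\<close> raised by two.\<close>
  let ?S = "{Suc (Suc lo)..<Suc (Suc lo) + 2 * i + L}"
  have eq: "{lo..<lo + 2 * Suc i + L} = insert lo (insert (Suc lo) ?S)" by auto
  have "wsum r t {lo..<lo + 2 * Suc i + L} S0 B = wsum r t ?S S0 B *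
      (bracket_factor r t (card ?S + 1) * bracket_factor r t (card ?S + 2))"
    unfolding eq using Suc.prems by (intro wsum_pair) auto
  also have "card ?S = L + 2 * i" by simp
  finally show ?case using Suc.IH[of "Suc (Suc lo)"] Suc.prems by (simp add: mult.assoc)
qed simp

text \<open>For odd \<open>lo\<close> an even number of letters lies below the interval; the parity
  of \<open>n + L\<close> makes the number above even too, so all outside letters pair off.\<close>

lemma wsum_interval:
  assumes "S0 \<subseteq> {lo..<lo + L}" "odd lo" "lo + L \<le> Suc n" "even (n + L)"
  shows "wsum r t {1..n} S0 B
    = wsum r t {lo..<lo + L} S0 B * (\<Prod>j\<in>{L + 1..n}. bracket_factor r t j)"
proof -
  obtain i where i: "lo = 1 + 2 * i" using assms(2) by (auto elim: oddE)
  have "even (n - (2 * i + L))" using assms by (simp add: i)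
  then obtain j where "n - (2 * i + L) = 2 * j" by (elim evenE)
  then have n: "n = 2 * i + L + 2 * j" using assms(3) by (simp add: i)
  have "wsum r t {1..n} S0 B = wsum r t {1..<1 + (2 * i + L) + 2 * j} S0 B"
    by (rule arg_cong[of _ _ "\<lambda>S. wsum r t S S0 B"]) (auto simp: n)
  also have "\<dots> = wsum r t {1..<1 + (2 * i + L)} S0 B
      * (\<Prod>j\<in>{2 * i + L + 1..2 * i + L + 2 * j}. bracket_factor r t j)"
    using assms(1) by (intro wsum_pairs_above) (auto simp: i)
  also have "{1..<1 + (2 * i + L)} = {1..<1 + 2 * i + L}" by simp
  also have "wsum r t {1..<1 + 2 * i + L} S0 B
      = wsum r t {lo..<lo + L} S0 B * (\<Prod>j\<in>{L + 1..L + 2 * i}. bracket_factor r t j)"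
    using assms(1) unfolding i by (intro wsum_pairs_below)
  finally have "wsum r t {1..n} S0 B = wsum r t {lo..<lo + L} S0 B
      * ((\<Prod>j\<in>{L + 1..L + 2 * i}. bracket_factor r t j)
      * (\<Prod>j\<in>{2 * i + L + 1..2 * i + L + 2 * j}. bracket_factor r t j))"
    by (simp only: mult.assoc)
  also have "{L + 1..n} = {L + 1..L + 2 * i} \<union> {2 * i + L + 1..2 * i + L + 2 * j}"
    by (auto simp: n)
  then have "(\<Prod>j\<in>{L + 1..L + 2 * i}. bracket_factor r t j)
      * (\<Prod>j\<in>{2 * i + L + 1..2 * i + L + 2 * j}. bracket_factor r t j)
      = (\<Prod>j\<in>{L + 1..n}. bracket_factor r t j)"
    by (simp add: prod.union_disjoint[symmetric])
  finally show ?thesis .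
qed

end

section \<open>The block of consecutive letters\<close>

lemma length_uncolored [simp]: "length (uncolored xs) = length xs"
  by (simp add: uncolored_def)

lemma nth_uncolored [simp]: "i < length xs \<Longrightarrow> uncolored xs ! i = (xs ! i, 0)"
  by (simp add: uncolored_def)

lemma uncolored_upt_in_words: "1 \<le> r \<Longrightarrow> uncolored [lo..<hi] \<in> words r {lo..<hi}"
  by (auto simp: words_def uncolored_def comp_def image_image)

text \<open>In every color the letter \<open>p\<close> is below all the others, so it makes
  \<open>j\<close> inversions and the only descent is at \<open>j\<close>. For \<open>j = 0\<close>
  there is no descent and the formula still holds.\<close>

lemma weight_inserted_least:
  assumes "j \<le> k" "p < m"
  shows "weight r t (inserted p z j (uncolored [m..<m + k])) = t ^ z * (- (t ^ r)) ^ j"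
proof -
  let ?V = "uncolored [m..<m + k]"
  let ?w = "inserted p z j ?V"
  have split: "[m..<m + k] = [m..<m + j] @ [m + j..<m + k]"
    using assms(1) by (metis le_add_diff_inverse add.assoc upt_add_eq_append le_add1)
  have w: "?w = uncolored [m..<m + j] @ (p, z) # uncolored [m + j..<m + k]"
    using assms(1) by (simp add: inserted_def uncolored_def take_map drop_map)
  have "map fst ?w = [m..<m + j] @ p # [m + j..<m + k]"
    unfolding w by (simp add: uncolored_def comp_def)
  moreover have "filter (\<lambda>y. p < y) [m..<m + j] = [m..<m + j]"
    "filter (\<lambda>y. y < p) [m + j..<m + k] = []"
    using assms(2) by (auto intro!: filter_True simp: filter_empty_conv)
  ultimately have inv: "inversion_number (map fst ?w) = j"
    using inversion_number_sorted[of "[m..<m + k]"] by (simp add: inversion_number_insert split[symmetric])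
  have col: "col ?w = z"
    unfolding w by (simp add: col_def uncolored_def comp_def)
  have "{i. 1 \<le> i \<and> i < length ?w \<and> colored_less (?w ! i) (?w ! (i - 1))} = (if j = 0 then {} else {j})"
    using assms by (auto simp: nth_inserted colored_less_def split: if_splits)
  then have "majF ?w = j" by (simp add: majF_def)
  then show ?thesis
    by (simp add: weight_def fmaj_def inv col power_add power_mult power_minus[of "t ^ r"])
qed

lemma nth_inserted_upt:
  assumes "j \<le> k" "i \<le> k"
  shows "inserted c z j (uncolored [p..<p + k]) ! i
    = (if i < j then (p + i, 0) else if i = j then (c, z) else (p + i - 1, 0))"
  using assms by (simp add: nth_inserted)

lemma relabel_inserted_upt:
  assumes j: "j \<le> k" "j' \<le> k"
    and f: "\<And>i. i \<le> k \<Longrightarrow>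
      apfst f (if i < j then (p + i, 0) else if i = j then (c, z) else (p + i - 1, 0))
      = (if i < j' then (p' + i, 0) else if i = j' then (c', z') else (p' + i - 1, 0))"
  shows "relabel f (inserted c z j (uncolored [p..<p + k])) = inserted c' z' j' (uncolored [p'..<p' + k])"
proof (rule nth_equalityI)
  fix i assume "i < length (relabel f (inserted c z j (uncolored [p..<p + k])))"
  then have "i \<le> k" by simp
  then show "relabel f (inserted c z j (uncolored [p..<p + k])) ! i
      = inserted c' z' j' (uncolored [p'..<p' + k]) ! i"
    using f[of i] j by (simp add: relabel_def nth_inserted_upt)
qed simp

text \<open>The cycle on the whole block carries one insertion to the other. A nonzero color keeps
  the inserted letter below all other block letters before and after, so no comparison
  changes.\<close>

lemma wsum_inserted_colored:
  fixes t :: "'a::comm_ring_1"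
  assumes j: "j \<le> k" and z: "z \<noteq> 0" and S: "{p..p + k} \<subseteq> S"
  shows "wsum r t S {p..p + k} {inserted (p + k) z j (uncolored [p..<p + k])}
    = (-1) ^ k * wsum r t S {p..p + k} {inserted p z j (uncolored [Suc p..<Suc p + k])}"
proof -
  let ?u = "inserted (p + k) z j (uncolored [p..<p + k])" and ?f = "cyc p (p + k)"
  have rel: "relabel ?f ?u = inserted p z j (uncolored [Suc p..<Suc p + k])"
    by (rule relabel_inserted_upt[OF j j]) (use j in \<open>auto simp: cyc_def\<close>)
  have "wsum r t S {p..p + k} {relabel ?f ?u} = (-1) ^ k * wsum r t S {p..p + k} {?u}"
  proof (rule wsum_relabel[OF _ _ _ S])
    show "bij ?f" by (simp add: bij_cyc)
    show "?f v \<in> {p..p + k} \<longleftrightarrow> v \<in> {p..p + k}" for v by (auto simp: cyc_def)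
    show "?f v = v" if "v \<notin> {p..p + k}" for v using that by (auto simp: cyc_def)
    show "(-1 :: 'a) ^ inversion_number (map ?f xs) = (-1) ^ k * (-1) ^ inversion_number xs"
      if "distinct xs" "{p..p + k} \<subseteq> set xs" for xs
      using sign_cyc[of p "p + k" xs] that by simp
  next
    fix A x y C assume u: "?u = A @ x # y # C"
    have "set ?u = insert (p + k, z) ((\<lambda>v. (v, 0)) ` {p..<p + k})"
      by (simp add: set_inserted uncolored_def)
    then have "x \<in> insert (p + k, z) ((\<lambda>v. (v, 0)) ` {p..<p + k})"
      "y \<in> insert (p + k, z) ((\<lambda>v. (v, 0)) ` {p..<p + k})"
      unfolding u by auto
    then show "colored_less (apfst ?f y) (apfst ?f x) \<longleftrightarrow> colored_less y x"
      using z by (auto simp: colored_less_def cyc_def)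
  qed
  then show ?thesis
    unfolding rel by (simp add: mult.assoc[symmetric] power_add[symmetric])
qed

text \<open>Both words have their only descent after the first \<open>j + 1\<close> letters; the relabelling is a
  product of a cycle of length \<open>j + 1\<close> and one of length \<open>k - j\<close>.\<close>

lemma wsum_inserted_uncolored:
  fixes t :: "'a::comm_ring_1"
  assumes j: "j < k" and S: "{p..p + k} \<subseteq> S"
  shows "wsum r t S {p..p + k} {inserted (p + k) 0 j (uncolored [p..<p + k])}
    = - ((-1) ^ k) * wsum r t S {p..p + k} {inserted p 0 (Suc j) (uncolored [Suc p..<Suc p + k])}"
proof -
  let ?u = "inserted (p + k) 0 j (uncolored [p..<p + k])"
  define f where "f = cyc p (p + j) \<circ> cyc (p + j + 1) (p + k)"
  have f: "f v = (if p \<le> v \<and> v < p + j then Suc v else if v = p + j then p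
      else if p + j < v \<and> v < p + k then Suc v else if v = p + k then p + j + 1 else v)" for v
    using j by (auto simp: f_def cyc_def)
  have rel: "relabel f ?u = inserted p 0 (Suc j) (uncolored [Suc p..<Suc p + k])"
    by (rule relabel_inserted_upt) (use j in \<open>auto simp: f\<close>)
  have sign: "(-1 :: 'a) ^ inversion_number (map f xs) = - ((-1) ^ k) * (-1) ^ inversion_number xs"
    if xs: "distinct xs" "{p..p + k} \<subseteq> set xs" for xs
  proof -
    let ?g = "cyc (p + j + 1) (p + k)"
    let ?ys = "map ?g xs"
    have bij: "bij ?g" using j by (intro bij_cyc) auto
    have sub: "{p..p + j} \<subseteq> set ?ys"
    proof
      fix v assume v: "v \<in> {p..p + j}"
      then have "?g v = v" using j by (auto simp: cyc_def)
      moreover have "v \<in> set xs" using v xs(2) j by auto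
      ultimately show "v \<in> set ?ys" unfolding set_map by (metis imageI)
    qed
    have "distinct ?ys"
      using xs(1) bij_is_inj[OF bij] by (auto simp: distinct_map intro: inj_on_subset)
    then have "(-1 :: 'a) ^ inversion_number (map f xs) = (-1) ^ (p + j - p) * (-1) ^ inversion_number ?ys"
      unfolding f_def map_map[symmetric] using sub by (intro sign_cyc) auto
    also have "(-1 :: 'a) ^ inversion_number ?ys = (-1) ^ (p + k - (p + j + 1)) * (-1) ^ inversion_number xs"
      using xs j by (intro sign_cyc) auto
    \<comment> \<open>The two cycles consist of \<open>j\<close> and \<open>k - j - 1\<close>
      exchanges of consecutive values, together \<open>k - 1\<close>; \<open>j < k\<close> makes
      this a genuine subtraction.\<close>
    also have "(-1 :: 'a) ^ (p + j - p) * ((-1) ^ (p + k - (p + j + 1)) * (-1) ^ inversion_number xs)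
        = (-1) ^ (k - 1) * (-1) ^ inversion_number xs"
      using j by (simp add: mult.assoc[symmetric] power_add[symmetric])
    also have "(-1 :: 'a) ^ (k - 1) = - ((-1) ^ k)"
      using j by (cases k) auto
    finally show ?thesis .
  qed
  have "wsum r t S {p..p + k} {relabel f ?u} = - ((-1) ^ k) * wsum r t S {p..p + k} {?u}"
  proof (rule wsum_relabel[OF _ _ _ S])
    show "bij f" unfolding f_def using j by (intro bij_comp bij_cyc) auto
    show "f v \<in> {p..p + k} \<longleftrightarrow> v \<in> {p..p + k}" for v using j by (auto simp: f)
    show "f v = v" if "v \<notin> {p..p + k}" for v using that j by (auto simp: f)
  next
    fix A x y C assume u: "?u = A @ x # y # C"
    have x: "x = ?u ! length A" and y: "y = ?u ! Suc (length A)"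
      unfolding u by (simp_all add: nth_append)
    have "length ?u = length A + Suc (Suc (length C))" unfolding u by simp
    then have A: "length A < k" by simp
    have "x = (if length A < j then (p + length A, 0) else if length A = j then (p + k, 0) else (p + length A - 1, 0))"
      unfolding x using A j by (subst nth_inserted_upt) auto
    moreover have "y = (if Suc (length A) < j then (p + Suc (length A), 0)
        else if Suc (length A) = j then (p + k, 0) else (p + length A, 0))"
      unfolding y using A j by (subst nth_inserted_upt) auto
    ultimately show "colored_less (apfst f y) (apfst f x) \<longleftrightarrow> colored_less y x"
      using A j by (auto simp: colored_less_def f)
  qed (use sign in blast)
  then show ?thesis
    unfolding rel by (simp add: mult.assoc[symmetric] power_add[symmetric])
qed

text \<open>The letter \<open>a\<close> is the least and all others are uncolored, so it stays below
  them in every color: recoloring it changes no comparison and only adds \<open>y\<close> to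
  \<open>col\<close>.\<close>

lemma sum_pair_insertions_recolor:
  fixes t :: "'a::comm_ring_1"
  assumes w: "\<And>x. x \<in> set w \<Longrightarrow> snd x = 0 \<and> a < fst x" and y: "y < r"
    and S: "a \<notin> S" "Suc a \<notin> S"
  shows "sum (weight r t) (pair_insertions r S a y 0 w) = t ^ y * sum (weight r t) (pair_insertions r S a 0 0 w)"
proof -
  define g where "g = (\<lambda>c (x :: colored_int). (fst x, if fst x = a then c else snd x))"
  have fst_g: "fst (g c x) = fst x" for c x by (simp add: g_def)
  have map_fst: "map fst (map (g c) w') = map fst w'" for c w' by (simp add: comp_def fst_g)
  have in_g: "map (g c) w' \<in> pair_insertions r S a c 0 w"
    if w': "w' \<in> pair_insertions r S a d 0 w" and c: "c < r" for c d w'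
  proof -
    have *: "w' \<in> words r (insert a (insert (Suc a) S))" "letters_in S w' = w"
      "(a, d) \<in> set w'" "(Suc a, 0) \<in> set w'"
      using w' by (auto simp: pair_insertions_def)
    have "fst ` set (map (g c) w') = fst ` set w'"
      by (simp only: map_fst set_map[symmetric])
    moreover have "\<forall>x\<in>set (map (g c) w'). snd x < r"
      using *(1) c by (auto simp: words_def g_def)
    ultimately have W: "map (g c) w' \<in> words r (insert a (insert (Suc a) S))"
      using *(1) unfolding words_def mem_Collect_eq map_fst by simp
    have "letters_in S (map (g c) w') = map (g c) (letters_in S w')"
      by (simp add: letters_in_def filter_map comp_def fst_g)
    moreover have "g c x = x" if "x \<in> set w" for x
      using w[OF that] by (simp add: g_def prod_eq_iff)
    ultimately have "letters_in S (map (g c) w') = w"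
      using *(2) by (simp add: map_idI)
    moreover have "g c (a, d) \<in> set (map (g c) w')" "g c (Suc a, 0) \<in> set (map (g c) w')"
      unfolding set_map by (rule imageI, fact)+
    ultimately show ?thesis using W by (simp add: pair_insertions_def g_def)
  qed
  have g_g: "map (g d) (map (g c) w') = w'" if w': "w' \<in> pair_insertions r S a d 0 w" for c d w'
  proof -
    have d: "distinct (map fst w')" "(a, d) \<in> set w'" using w' by (auto simp: pair_insertions_def words_def)
    have "g d (g c x) = x" if "x \<in> set w'" for x
      using eq_key_imp_eq_value[OF d(1), of a d "snd x"] d(2) that by (cases x) (auto simp: g_def)
    then show ?thesis by (auto intro!: map_idI simp: comp_def)
  qed
  have weight_g: "weight r t (map (g y) w') = t ^ y * weight r t w'"
    if w': "w' \<in> pair_insertions r S a 0 0 w" for w'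
  proof -
    have *: "w' \<in> words r (insert a (insert (Suc a) S))" "letters_in S w' = w"
      "(a, 0) \<in> set w'" "(Suc a, 0) \<in> set w'" "distinct (map fst w')"
      using w' by (auto simp: pair_insertions_def words_def)
    have uncolored: "snd x = 0 \<and> a \<le> fst x" if x: "x \<in> set w'" for x
    proof -
      have "fst x \<in> insert a (insert (Suc a) S)" using words_memD(1)[OF *(1) x] .
      then consider "fst x = a" | "fst x = Suc a" | "fst x \<in> S" by blast
      then show ?thesis
      proof cases
        case 1
        with *(3) have "snd x = 0" using eq_key_imp_eq_value[OF *(5), of a "snd x" 0] x by (metis prod.collapse)
        with 1 show ?thesis by simp
      next
        case 2
        with *(4) have "snd x = 0" using eq_key_imp_eq_value[OF *(5), of "Suc a" "snd x" 0] x by (metis prod.collapse)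
        with 2 show ?thesis by simp
      next
        case 3
        then have "x \<in> set w" using *(2) x by (auto simp: letters_in_def)
        then show ?thesis using w[of x] by simp
      qed
    qed
    have "majF (map (g y) w') = majF w'"
    proof (rule majF_map)
      fix A x x' C assume eq: "w' = A @ x # x' # C"
      have "fst x \<noteq> fst x'" using *(5) eq by auto
      moreover have "snd x = 0 \<and> a \<le> fst x" "snd x' = 0 \<and> a \<le> fst x'"
        using uncolored eq by simp_all
      ultimately show "colored_less (g y x') (g y x) \<longleftrightarrow> colored_less x' x"
        by (auto simp: colored_less_def g_def)
    qed
    moreover have "col (map (g y) w') = y + col w'"
    proof -
      obtain A C where eq: "w' = A @ (a, 0) # C" using *(3) by (meson split_list)
      have "map (g y) A = A" "map (g y) C = C"
        using *(5) eq by (auto intro!: map_idI simp: g_def image_iff)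
      then show ?thesis by (simp add: eq g_def)
    qed
    ultimately show ?thesis
      unfolding weight_def map_fst fmaj_def by (simp add: power_add algebra_simps)
  qed
  show ?thesis
    unfolding sum_distrib_left
  proof (rule sum.reindex_bij_witness[of _ "map (g y)" "map (g 0)"])
    fix w' assume w': "w' \<in> pair_insertions r S a y 0 w"
    show *: "map (g 0) w' \<in> pair_insertions r S a 0 0 w" using w' y by (intro in_g) auto
    show "t ^ y * weight r t (map (g 0) w') = weight r t w'"
      using weight_g[OF *] g_g[OF w'] by simp
  qed (use in_g g_g y in auto)
qed

lemma subseq_letters_in: "subseq (letters_in S u) u"
  by (simp add: letters_in_def)

lemma weight_uncolored_upt: "weight r t (uncolored [m..<m + k]) = 1"
proof -
  have "{i. 1 \<le> i \<and> i < k \<and> colored_less (uncolored [m..<m + k] ! i) (uncolored [m..<m + k] ! (i - 1))} = {}"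
    by (auto simp: colored_less_def)
  then have "majF (uncolored [m..<m + k]) = 0" by (simp add: majF_def)
  moreover have "map fst (uncolored [m..<m + k]) = [m..<m + k]" "col (uncolored [m..<m + k]) = 0"
    by (simp_all add: uncolored_def comp_def col_def)
  ultimately show ?thesis
    by (simp add: weight_def fmaj_def inversion_number_sorted)
qed

text \<open>Both sides run over the words on \<open>{a..Suc a + k}\<close> that contain
  \<open>V\<close> and give \<open>Suc a\<close> the color \<open>z\<close>: on the left sorted by
  the place of \<open>Suc a\<close> in \<open>V\<close>, on the right by the color \<open>y\<close>
  of \<open>a\<close>.\<close>

lemma sum_wsum_inserted_eq_pair_insertions:
  fixes t :: "'a::comm_ring_1" and a k :: nat
  assumes z: "z < r"
  defines "V \<equiv> uncolored [Suc (Suc a)..<Suc (Suc a) + k]"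
  shows "(\<Sum>j\<le>k. wsum r t {a..Suc a + k} {Suc a..Suc a + k} {inserted (Suc a) z j V})
    = (\<Sum>y<r. sum (weight r t) (pair_insertions r {Suc (Suc a)..<Suc (Suc a) + k} a y z V))"
proof -
  let ?S = "{Suc (Suc a)..<Suc (Suc a) + k}" and ?N = "{a..Suc a + k}" and ?M = "{Suc a..Suc a + k}"
  have N: "insert a (insert (Suc a) ?S) = ?N" and M: "insert (Suc a) ?S = ?M" by auto
  have V: "V \<in> words r ?S"
    unfolding V_def using z by (intro uncolored_upt_in_words) simp
  have lenV: "length V = k"
    unfolding V_def length_uncolored length_upt by simp
  have color: "\<exists>y<r. (v, y) \<in> set w" if "w \<in> words r ?N" "v \<in> ?N" for w v
  proof -
    have "v \<in> fst ` set w" using that by (auto simp: words_def)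
    then show ?thesis using words_memD(2)[OF that(1)] by fastforce
  qed
  have uniq: "y = y'" if "w' \<in> words r X" "(v, y) \<in> set w'" "(v, y') \<in> set w'" for w' v y y' X
    using that by (auto simp: words_def dest: eq_key_imp_eq_value)
  have res: "letters_in ?S (letters_in ?M w) = letters_in ?S w" for w
  proof -
    have "?M \<inter> ?S = ?S" by auto
    then show ?thesis by (simp only: letters_in_letters_in)
  qed
  have "{w \<in> words r ?N. letters_in ?M w \<in> (\<lambda>j. inserted (Suc a) z j V) ` {..k}}
      = (\<Union>y<r. pair_insertions r ?S a y z V)" (is "?L = ?R")
  proof (rule set_eqI, rule iffI)
    fix w assume w: "w \<in> ?L"
    then obtain j where j: "letters_in ?M w = inserted (Suc a) z j V" by auto
    then have "letters_in ?S w = letters_in ?S (inserted (Suc a) z j V)" by (metis res)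
    also have "\<dots> = V" by (rule letters_in_inserted[OF V]) simp
    finally have "letters_in ?S w = V" .
    moreover have "(Suc a, z) \<in> set (letters_in ?M w)" unfolding j set_inserted by simp
    then have "(Suc a, z) \<in> set w" by (simp add: letters_in_def)
    moreover have "w \<in> words r (insert a (insert (Suc a) ?S))" using w unfolding N by simp
    moreover obtain y where "y < r" "(a, y) \<in> set w" using w color[of w a] by auto
    ultimately show "w \<in> ?R" unfolding pair_insertions_def by blast
  next
    fix w assume "w \<in> ?R"
    then obtain y where "w \<in> pair_insertions r ?S a y z V" by blast
    then have w: "w \<in> words r ?N" "letters_in ?S w = V" "(Suc a, z) \<in> set w"
      unfolding pair_insertions_def N by simp_all
    let ?u = "letters_in ?M w"
    have u: "?u \<in> words r (insert (Suc a) ?S)"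
      using letters_in_words[OF w(1), of ?M] unfolding M by (simp add: Int_absorb1)
    have "V = letters_in ?S ?u" by (simp only: w(2) res)
    then have "subseq V ?u" by (metis subseq_letters_in)
    then obtain z' j where zj: "j \<le> length V" "?u = inserted (Suc a) z' j V"
      using subseq_imp_inserted[OF u V] by auto
    have "(Suc a, z) \<in> set ?u" using w(3) by (simp add: letters_in_def)
    moreover have "(Suc a, z') \<in> set ?u" unfolding zj(2) set_inserted by simp
    ultimately have "z' = z" using uniq[OF u] by blast
    then show "w \<in> ?L" using w(1) zj lenV by auto
  qed
  then have "sum (weight r t) (\<Union>y<r. pair_insertions r ?S a y z V)
      = wsum r t ?N ?M ((\<lambda>j. inserted (Suc a) z j V) ` {..k})"
    by (simp add: wsum_def)
  also have "\<dots> = (\<Sum>j\<le>k. wsum r t ?N ?M {inserted (Suc a) z j V})"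
  proof (rule wsum_image)
    show "inj_on (\<lambda>j. inserted (Suc a) z j V) {..k}"
      using inserted_inj[OF V, of "Suc a"] lenV by (auto simp: inj_on_def)
  qed simp_all
  also have "sum (weight r t) (\<Union>y<r. pair_insertions r ?S a y z V)
      = (\<Sum>y<r. sum (weight r t) (pair_insertions r ?S a y z V))"
    by (rule sum.UNION_disjoint; simp add: finite_pair_insertions)
       (auto simp: pair_insertions_def dest: uniq)
  finally show ?thesis ..
qed

section \<open>Sums over the insertions of \<open>p\<close>, for odd and for even
  \<open>p\<close>\<close>

context non_torsion
begin

text \<open>For odd \<open>p\<close> all letters outside the block pair off. Within the block, the
  insertion after \<open>j\<close> letters contributes \<open>t ^ z * (- T) ^ j\<close>, a geometric
  sum in \<open>j\<close>.\<close>

lemma sum_wsum_inserted: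
  assumes z: "z < r" and p: "odd p" "p + k \<le> n" "odd (n + k)"
  shows "(\<Sum>j\<le>k. wsum r t {1..n} {p..p + k} {inserted p z j (uncolored [Suc p..<Suc p + k])})
    = t ^ z * qbracket (k + 1) (- T) * (\<Prod>i\<in>{k + 2..n}. bracket_factor r t i)"
proof -
  let ?V = "uncolored [Suc p..<Suc p + k]" and ?P = "\<Prod>i\<in>{k + 2..n}. bracket_factor r t i"
  have eq: "{p..p + k} = {p..<p + (k + 1)}" "insert p {Suc p..<Suc p + k} = {p..p + k}" by auto
  have "wsum r t {1..n} {p..p + k} {inserted p z j ?V} = t ^ z * (- T) ^ j * ?P" if "j \<le> k" for j
  proof -
    have "wsum r t {1..n} {p..p + k} {inserted p z j ?V}
        = wsum r t {p..p + k} {p..p + k} {inserted p z j ?V} * ?P"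
      using p wsum_interval[of "{p..p + k}" p "k + 1" n] by (simp add: eq(1))
    also have "wsum r t {p..p + k} {p..p + k} {inserted p z j ?V} = weight r t (inserted p z j ?V)"
      using inserted_in_words[OF uncolored_upt_in_words[OF r_pos, of "Suc p" "Suc p + k"], of p z j] z
      by (intro wsum_self) (simp only: eq(2), simp)
    also have "\<dots> = t ^ z * (- T) ^ j" using that by (intro weight_inserted_least) auto
    finally show ?thesis .
  qed
  then have "(\<Sum>j\<le>k. wsum r t {1..n} {p..p + k} {inserted p z j ?V}) = (\<Sum>j\<le>k. t ^ z * (- T) ^ j * ?P)"
    by (intro sum.cong) auto
  then show ?thesis
    by (simp add: qbracket_def lessThan_Suc_atMost sum_distrib_left sum_distrib_right)
qed

text \<open>For even \<open>p\<close> the letter \<open>p - 1\<close> is left over when the free letters are paired up. It is treated as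
  the lower letter of a pair with \<open>p\<close>, and \<open>H y z\<close> is the signed sum over the words in which \<open>p - 1\<close> has
  color \<open>y\<close> and \<open>p\<close> has color \<open>z\<close>.\<close>

lemma sum_wsum_inserted_unpaired:
  fixes p k n :: nat
  assumes p: "even p" "1 \<le> p" "p + k \<le> n" "even (n + k)"
  defines "V \<equiv> uncolored [Suc p..<Suc p + k]"
  obtains H where "H 0 0 * (1 - T ^ 2) = (1 - T ^ (k + 1)) * (1 - T ^ (k + 2))"
    and "\<And>y z. y \<noteq> z \<Longrightarrow> H y z = - H z y" and "\<And>z. z < r \<Longrightarrow> H z z = t ^ (2 * z) * H 0 0"
    and "\<And>y. y < r \<Longrightarrow> H y 0 = t ^ y * H 0 0"
    and "\<And>z. z < r \<Longrightarrow> (\<Sum>j\<le>k. wsum r t {1..n} {p..p + k} {inserted p z j V})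
      = (\<Sum>y<r. H y z) * (\<Prod>i\<in>{k + 3..n}. bracket_factor r t i)"
proof -
  obtain a where a: "p = Suc a" using p(2) by (cases p) auto
  let ?S = "{Suc (Suc a)..<Suc (Suc a) + k}"
  have V: "V \<in> words r ?S"
    unfolding V_def a by (rule uncolored_upt_in_words[OF r_pos])
  have lenV: "length V = k"
    unfolding V_def length_uncolored length_upt by simp
  have wV: "weight r t V = 1" unfolding V_def by (rule weight_uncolored_upt)
  define H where "H = (\<lambda>y z. sum (weight r t) (pair_insertions r ?S a y z V))"
  have diag: "H z z * (1 - T ^ 2) = t ^ (2 * z) * ((1 - T ^ (k + 1)) * (1 - T ^ (k + 2)))" if "z < r" for z
    using sum_pair_insertions_diag[OF V, of a z t] that by (simp add: H_def wV lenV mult.assoc)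
  show ?thesis
  proof (rule that[of H])
    show H0: "H 0 0 * (1 - T ^ 2) = (1 - T ^ (k + 1)) * (1 - T ^ (k + 2))"
      using diag[of 0] r_pos by simp
    show "H z z = t ^ (2 * z) * H 0 0" if "z < r" for z
    proof -
      have "H z z * (1 - T ^ 2) = t ^ (2 * z) * H 0 0 * (1 - T ^ 2)"
        using diag[OF that] H0 by (simp only: mult.assoc)
      then show ?thesis using one_minus_ne_0(2) by (metis mult_right_cancel)
    qed
    show "H y z = - H z y" if "y \<noteq> z" for y z
      unfolding H_def using that by (intro sum_pair_insertions_antisym) auto
    show "H y 0 = t ^ y * H 0 0" if "y < r" for y
      unfolding H_def using that
      by (intro sum_pair_insertions_recolor) (auto simp: V_def a uncolored_def)
    show "(\<Sum>j\<le>k. wsum r t {1..n} {p..p + k} {inserted p z j V})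
      = (\<Sum>y<r. H y z) * (\<Prod>i\<in>{k + 3..n}. bracket_factor r t i)" if "z < r" for z
    proof -
      \<comment> \<open>Enlarged by \<open>a = p - 1\<close>, the block is an interval of
        \<open>k + 2\<close> letters with an odd least element, and the letters outside it pair off;
        hence the product starts at \<open>k + 3\<close>.\<close>
      have "{a..<a + (k + 2)} = {a..Suc a + k}" by auto
      moreover have "k + 2 + 1 = k + 3" by simp
      ultimately have "wsum r t {1..n} {p..p + k} B
          = wsum r t {a..Suc a + k} {p..p + k} B * (\<Prod>i\<in>{k + 3..n}. bracket_factor r t i)" for B
        using wsum_interval[of "{p..p + k}" a "k + 2" n B] p by (auto simp: a numeral_3_eq_3)
      then show ?thesis
        using sum_wsum_inserted_eq_pair_insertions[OF that, of t a k]
        by (simp add: a V_def H_def sum_distrib_right[symmetric])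
    qed
  qed
qed

text \<open>The terms with \<open>z = 0\<close> add up to \<open>qbracket r t * H 0 0\<close>. As
  \<open>k + 1\<close> is even, \<open>1 - T ^ (k + 1)\<close> is divisible by \<open>1 + T\<close>,
  while \<open>1 - T\<close> divides \<open>1 - T ^ (k + 2)\<close>; this splits
  \<open>H 0 0\<close> into two brackets.\<close>

lemma sum_wsum_inserted_unpaired_odd:
  assumes p: "even p" "1 \<le> p" "p + k \<le> n" "even (n + k)" and k: "odd k"
  shows "(\<Sum>j\<le>k. wsum r t {1..n} {p..p + k} {inserted p 0 j (uncolored [Suc p..<Suc p + k])})
    = qbracket (k + 1) (- T) * qbracket (k + 2) T * qbracket r t * (\<Prod>i\<in>{k + 3..n}. bracket_factor r t i)"
proof (rule sum_wsum_inserted_unpaired[OF p])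
  fix H
  assume H0: "H 0 0 * (1 - T ^ 2) = (1 - T ^ (k + 1)) * (1 - T ^ (k + 2))"
    and Hy: "\<And>y. y < r \<Longrightarrow> H y 0 = t ^ y * H 0 0"
    and W: "\<And>z. z < r \<Longrightarrow> (\<Sum>j\<le>k. wsum r t {1..n} {p..p + k} {inserted p z j (uncolored [Suc p..<Suc p + k])})
      = (\<Sum>y<r. H y z) * (\<Prod>i\<in>{k + 3..n}. bracket_factor r t i)"
  have "qbracket (k + 1) (- T) * (1 + T) = 1 - T ^ (k + 1)"
    using qbracket_mult_one_minus[of "k + 1" "- T"] k by simp
  moreover have "qbracket (k + 2) T * (1 - T) = 1 - T ^ (k + 2)"
    by (rule qbracket_mult_one_minus)
  ultimately have "H 0 0 * (1 - T ^ 2)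
      = (qbracket (k + 1) (- T) * (1 + T)) * (qbracket (k + 2) T * (1 - T))"
    using H0 by simp
  also have "\<dots> = qbracket (k + 1) (- T) * qbracket (k + 2) T * ((1 - T) * (1 + T))"
    by (simp only: mult.assoc mult.left_commute mult.commute)
  also have "(1 - T) * (1 + T) = 1 - T ^ 2"
    by (simp add: algebra_simps power2_eq_square)
  finally have "H 0 0 = qbracket (k + 1) (- T) * qbracket (k + 2) T"
    using one_minus_ne_0(2) by (metis mult_right_cancel)
  moreover have "(\<Sum>y<r. H y 0) = (\<Sum>y<r. t ^ y * H 0 0)"
    by (rule sum.cong) (use Hy in blast)+
  then have "(\<Sum>y<r. H y 0) = qbracket r t * H 0 0"
    by (simp only: qbracket_def sum_distrib_right)
  ultimately show ?thesis using W[of 0] r_pos by (simp add: mult.commute)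
qed

text \<open>The right side is f(r; q) for t = \<zeta>^h q. Its brackets have the denominators
  \<open>1 - s * t\<close> and \<open>1 + s * t\<close> with \<open>s = (-1) ^ r\<close>, whose
  product is \<open>1 - t ^ 2\<close>; r (r - 1) and r (r + 1) are even, so the numerators carry no
  sign.\<close>

lemma qbracket_square_minus:
  "qbracket r (t ^ 2) - qbracket r t = - t * qbracket (r - 1) ((-1) ^ r * t) * qbracket r ((-1) ^ (r - 1) * t)"
proof -
  define s where "s = (-1 :: 'a) ^ r"
  obtain m where m: "r = Suc m" using r_pos by (cases r) auto
  have s: "s * s = 1" "(-1) ^ (r - 1) = - s" "s ^ (r - 1) = 1" "(- s) ^ r = 1"
    unfolding s_def by (simp_all add: m uminus_power_if)
  have 1: "qbracket (r - 1) (s * t) * (1 - s * t) = 1 - t ^ (r - 1)"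
    "qbracket r (- s * t) * (1 - (- s) * t) = 1 - t ^ r"
    unfolding qbracket_mult_one_minus power_mult_distrib s by simp_all
  have "(1 - s * t) * (1 - (- s) * t) = 1 - (s * s) * t ^ 2"
    by (simp add: algebra_simps power2_eq_square)
  then have 2: "(1 - s * t) * (1 - (- s) * t) = 1 - t ^ 2" by (simp add: s)
  have "(- t * qbracket (r - 1) (s * t) * qbracket r (- s * t)) * (1 - t ^ 2)
      = - t * (qbracket (r - 1) (s * t) * (1 - s * t)) * (qbracket r (- s * t) * (1 - (- s) * t))"
    unfolding 2[symmetric] by (simp only: mult.assoc mult.left_commute mult.commute)
  also have "\<dots> = - t * (1 - t ^ (r - 1)) * (1 - t ^ r)" unfolding 1 ..
  also have "\<dots> = (1 - t ^ r * t ^ r) - (1 - t ^ r) * (1 + t)"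
    by (simp add: m algebra_simps)
  also have "\<dots> = qbracket r (t ^ 2) * (1 - t ^ 2) - (qbracket r t * (1 - t)) * (1 + t)"
    unfolding qbracket_mult_one_minus by (simp add: power2_eq_square power_mult_distrib)
  also have "\<dots> = (qbracket r (t ^ 2) - qbracket r t) * (1 - t ^ 2)"
    by (simp add: algebra_simps power2_eq_square)
  finally show ?thesis
    using one_minus_ne_0(1) unfolding s_def[symmetric] s(2) by (metis mult_right_cancel)
qed

text \<open>By antisymmetry the total over all colors is the diagonal,
  \<open>qbracket r (t ^ 2) * H 0 0\<close>; removing the terms with \<open>z = 0\<close> subtracts
  \<open>qbracket r t * H 0 0\<close>. For even \<open>k\<close> it is
  \<open>1 - T ^ (k + 2)\<close> that is divided by \<open>1 + T\<close>.\<close>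

lemma sum_wsum_inserted_unpaired_even:
  assumes p: "even p" "1 \<le> p" "p + k \<le> n" "even (n + k)" and k: "even k"
  shows "(\<Sum>z\<in>{1..<r}. \<Sum>j\<le>k. wsum r t {1..n} {p..p + k} {inserted p z j (uncolored [Suc p..<Suc p + k])})
    = (qbracket r (t ^ 2) - qbracket r t) * qbracket (k + 1) T * qbracket (k + 2) (- T)
      * (\<Prod>i\<in>{k + 3..n}. bracket_factor r t i)"
proof (rule sum_wsum_inserted_unpaired[OF p])
  fix H
  assume H0: "H 0 0 * (1 - T ^ 2) = (1 - T ^ (k + 1)) * (1 - T ^ (k + 2))"
    and anti: "\<And>y z. y \<noteq> z \<Longrightarrow> H y z = - H z y" and diag: "\<And>z. z < r \<Longrightarrow> H z z = t ^ (2 * z) * H 0 0"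
    and Hy: "\<And>y. y < r \<Longrightarrow> H y 0 = t ^ y * H 0 0"
    and W: "\<And>z. z < r \<Longrightarrow> (\<Sum>j\<le>k. wsum r t {1..n} {p..p + k} {inserted p z j (uncolored [Suc p..<Suc p + k])})
      = (\<Sum>y<r. H y z) * (\<Prod>i\<in>{k + 3..n}. bracket_factor r t i)"
  have "qbracket (k + 2) (- T) * (1 + T) = 1 - T ^ (k + 2)"
    using qbracket_mult_one_minus[of "k + 2" "- T"] k by simp
  moreover have "qbracket (k + 1) T * (1 - T) = 1 - T ^ (k + 1)"
    by (rule qbracket_mult_one_minus)
  ultimately have "H 0 0 * (1 - T ^ 2)
      = (qbracket (k + 1) T * (1 - T)) * (qbracket (k + 2) (- T) * (1 + T))"
    using H0 by simp
  also have "\<dots> = qbracket (k + 1) T * qbracket (k + 2) (- T) * ((1 - T) * (1 + T))"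
    by (simp only: mult.assoc mult.left_commute mult.commute)
  also have "(1 - T) * (1 + T) = 1 - T ^ 2"
    by (simp add: algebra_simps power2_eq_square)
  finally have H0': "H 0 0 = qbracket (k + 1) T * qbracket (k + 2) (- T)"
    using one_minus_ne_0(2) by (metis mult_right_cancel)
  have "{..<r} = insert 0 {1..<r}" using r_pos by auto
  then have "(\<Sum>z<r. \<Sum>y<r. H y z) = (\<Sum>y<r. H y 0) + (\<Sum>z\<in>{1..<r}. \<Sum>y<r. H y z)" by simp
  moreover have "(\<Sum>z<r. \<Sum>y<r. H y z) = (\<Sum>z<r. H z z)"
    by (rule sum_antisymmetric[of "\<lambda>z y. H y z"], rule anti) blast
  moreover have "(\<Sum>z<r. H z z) = (\<Sum>z<r. t ^ (2 * z) * H 0 0)"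
    by (rule sum.cong) (use diag in blast)+
  then have "(\<Sum>z<r. H z z) = qbracket r (t ^ 2) * H 0 0"
    by (simp only: qbracket_def sum_distrib_right power_mult)
  moreover have "(\<Sum>y<r. H y 0) = (\<Sum>y<r. t ^ y * H 0 0)"
    by (rule sum.cong) (use Hy in blast)+
  then have "(\<Sum>y<r. H y 0) = qbracket r t * H 0 0"
    by (simp only: qbracket_def sum_distrib_right)
  ultimately have "(\<Sum>z\<in>{1..<r}. \<Sum>y<r. H y z) = (qbracket r (t ^ 2) - qbracket r t) * H 0 0"
    by (simp only: left_diff_distrib add_diff_cancel_left')
  moreover have "(\<Sum>z\<in>{1..<r}. \<Sum>j\<le>k. wsum r t {1..n} {p..p + k} {inserted p z j (uncolored [Suc p..<Suc p + k])})
      = (\<Sum>z\<in>{1..<r}. (\<Sum>y<r. H y z) * (\<Prod>i\<in>{k + 3..n}. bracket_factor r t i))"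
    by (intro sum.cong refl W) simp
  ultimately show ?thesis
    by (simp only: sum_distrib_right[symmetric] H0' mult.assoc)
qed

end

section \<open>Comparing the two kinds of insertions\<close>

declare upt_Suc [simp del]

text \<open>Both sides are the increasing uncolored block p, ..., p + k.\<close>

lemma inserted_greatest_last_eq:
  "inserted (p + k) 0 k (uncolored [p..<p + k]) = inserted p 0 0 (uncolored [Suc p..<Suc p + k])"
proof (rule nth_equalityI)
  fix i assume "i < length (inserted (p + k) 0 k (uncolored [p..<p + k]))"
  then have "i \<le> k" by simp
  then show "inserted (p + k) 0 k (uncolored [p..<p + k]) ! i
      = inserted p 0 0 (uncolored [Suc p..<Suc p + k]) ! i"
    by (subst (1 2) nth_inserted_upt) auto
qed (simp add: length_inserted)

definition insertions :: "nat \<Rightarrow> nat \<Rightarrow> colored_int list \<Rightarrow> colored_int list set" where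
  "insertions r c U = (\<lambda>(z, j). inserted c z j U) ` ({..<r} \<times> {..length U})"

lemma insertionsE:
  assumes "u \<in> insertions r c U"
  obtains z j where "j \<le> length U" "u = inserted c z j U"
  using assms by (auto simp: insertions_def)

lemma wsum_insertions:
  assumes U: "U \<in> words r S" "c \<notin> S" and fin: "finite N"
  shows "wsum r t N S0 (insertions r c U) = (\<Sum>z<r. \<Sum>j\<le>length U. wsum r t N S0 {inserted c z j U})"
proof -
  have "wsum r t N S0 (insertions r c U)
      = (\<Sum>i\<in>{..<r} \<times> {..length U}. wsum r t N S0 {case i of (z, j) \<Rightarrow> inserted c z j U})"
    unfolding insertions_def
    by (rule wsum_image) (use fin inserted_inj[OF U] in \<open>auto simp: inj_on_def\<close>)
  then show ?thesis by (simp add: sum.cartesian_product split_def)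
qed

text \<open>In a common word \<open>p + k\<close> is uncolored. If it were not last, the word would
  end in \<open>p + k - 1\<close>, whereas the other description ends in \<open>p\<close> or
  \<open>p + k\<close>. For \<open>k = 1\<close> the word p + 1, p would be common as well.\<close>

lemma insertions_Int:
  assumes r: "1 \<le> r" and k: "2 \<le> k"
  shows "insertions r (p + k) (uncolored [p..<p + k]) \<inter> insertions r p (uncolored [Suc p..<Suc p + k])
    = {inserted p 0 0 (uncolored [Suc p..<Suc p + k])}" (is "?L = ?R")
proof
  show "?R \<subseteq> ?L"
  proof -
    have "inserted (p + k) 0 k (uncolored [p..<p + k]) \<in> insertions r (p + k) (uncolored [p..<p + k])"
      using r by (auto simp: insertions_def image_iff intro!: bexI[of _ "(0, k)"])
    moreover have "inserted p 0 0 (uncolored [Suc p..<Suc p + k]) \<in> insertions r p (uncolored [Suc p..<Suc p + k])"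
      using r unfolding insertions_def by (intro image_eqI[of _ _ "(0, 0)"]) auto
    ultimately show ?thesis using inserted_greatest_last_eq[of p k] by simp
  qed
next
  show "?L \<subseteq> ?R"
  proof
    fix u assume "u \<in> ?L"
    then have "u \<in> insertions r (p + k) (uncolored [p..<p + k])"
      "u \<in> insertions r p (uncolored [Suc p..<Suc p + k])" by auto
    then obtain z j z' j' where j: "j \<le> k" "j' \<le> k"
      and u: "u = inserted (p + k) z j (uncolored [p..<p + k])"
      and u': "u = inserted p z' j' (uncolored [Suc p..<Suc p + k])"
      by (elim insertionsE) simp
    have "(p + k, 0) \<in> set u"
      unfolding u' set_inserted using k by (simp add: uncolored_def image_iff)
    then have z: "z = 0"
      unfolding u set_inserted by (auto simp: uncolored_def)
    have "j = k"
    proof (rule ccontr)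
      assume "j \<noteq> k"
      then have "u ! k = (p + k - 1, 0)"
        unfolding u using j by (subst nth_inserted_upt) auto
      moreover have "u ! k = (if j' = k then (p, z') else (p + k, 0))"
        unfolding u' using j by (subst nth_inserted_upt) auto
      ultimately show False using k by (auto split: if_splits)
    qed
    then show "u \<in> ?R" using u z inserted_greatest_last_eq[of p k] by simp
  qed
qed

lemma wsum_Diff:
  assumes "finite S"
  shows "wsum r t S S0 (B - C) = wsum r t S S0 B - wsum r t S S0 (B \<inter> C)"
proof -
  have "{w \<in> words r S. letters_in S0 w \<in> B - C}
      = {w \<in> words r S. letters_in S0 w \<in> B} - {w \<in> words r S. letters_in S0 w \<in> B \<inter> C}" by auto
  then show ?thesis
    unfolding wsum_def using assms by (simp only:) (intro sum_diff, auto simp: finite_words)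
qed

text \<open>Appending \<open>p + k\<close> at the end gives the increasing block, which is
  \<open>B 0 0\<close>; every other \<open>A 0 j\<close> matches \<open>B 0 (Suc j)\<close> up to
  the sign \<open>- ((-1) ^ k)\<close>.\<close>

lemma sum_uncolored_insertions:
  fixes t :: "'a::comm_ring_1" and r p k :: nat and S :: "nat set"
  assumes S: "{p..p + k} \<subseteq> S"
  defines "A \<equiv> \<lambda>z j. wsum r t S {p..p + k} {inserted (p + k) z j (uncolored [p..<p + k])}"
    and "B \<equiv> \<lambda>z j. wsum r t S {p..p + k} {inserted p z j (uncolored [Suc p..<Suc p + k])}"
  shows "(\<Sum>j\<le>k. A 0 j) = B 0 0 - (-1) ^ k * ((\<Sum>j\<le>k. B 0 j) - B 0 0)"
proof -
  have "(\<Sum>j\<le>k. A 0 j) = (\<Sum>j<k. A 0 j) + A 0 k"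
    by (simp only: lessThan_Suc_atMost[symmetric] sum.lessThan_Suc)
  also have "A 0 k = B 0 0"
    unfolding A_def B_def inserted_greatest_last_eq ..
  also have "(\<Sum>j<k. A 0 j) = (\<Sum>j<k. - ((-1) ^ k) * B 0 (Suc j))"
    unfolding A_def B_def using S by (intro sum.cong refl wsum_inserted_uncolored) auto
  also have "\<dots> = - ((-1) ^ k) * (\<Sum>j<k. B 0 (Suc j))" by (rule sum_distrib_left[symmetric])
  also have "(\<Sum>j<k. B 0 (Suc j)) = (\<Sum>j\<le>k. B 0 j) - B 0 0"
    by (simp add: lessThan_Suc_atMost[symmetric] sum.lessThan_Suc_shift del: sum.lessThan_Suc)
  finally show ?thesis by simp
qed

text \<open>Color zero is split off because the nonzero colors match with the opposite sign
  \<open>(-1) ^ k\<close>.\<close>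

lemma sum_insertions_split:
  fixes t :: "'a::comm_ring_1" and r p k :: nat and S :: "nat set"
  assumes S: "{p..p + k} \<subseteq> S" and r: "1 \<le> r"
  defines "A \<equiv> \<lambda>z j. wsum r t S {p..p + k} {inserted (p + k) z j (uncolored [p..<p + k])}"
    and "B \<equiv> \<lambda>z j. wsum r t S {p..p + k} {inserted p z j (uncolored [Suc p..<Suc p + k])}"
  shows "(\<Sum>z<r. \<Sum>j\<le>k. A z j) = B 0 0 - (-1) ^ k * ((\<Sum>j\<le>k. B 0 j) - B 0 0)
      + (-1) ^ k * (\<Sum>z\<in>{1..<r}. \<Sum>j\<le>k. B z j)"
    and "(\<Sum>z<r. \<Sum>j\<le>k. B z j) = (\<Sum>j\<le>k. B 0 j) + (\<Sum>z\<in>{1..<r}. \<Sum>j\<le>k. B z j)"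
proof -
  have eq: "{..<r} = insert 0 {1..<r}" using r by auto
  show "(\<Sum>z<r. \<Sum>j\<le>k. B z j) = (\<Sum>j\<le>k. B 0 j) + (\<Sum>z\<in>{1..<r}. \<Sum>j\<le>k. B z j)"
    unfolding eq by simp
  have "(\<Sum>z\<in>{1..<r}. \<Sum>j\<le>k. A z j) = (\<Sum>z\<in>{1..<r}. \<Sum>j\<le>k. (-1) ^ k * B z j)"
    unfolding A_def B_def using S by (intro sum.cong refl wsum_inserted_colored) auto
  moreover have "(\<Sum>j\<le>k. A 0 j) = B 0 0 - (-1) ^ k * ((\<Sum>j\<le>k. B 0 j) - B 0 0)"
    unfolding A_def B_def by (rule sum_uncolored_insertions[OF S])
  ultimately show "(\<Sum>z<r. \<Sum>j\<le>k. A z j) = B 0 0 - (-1) ^ k * ((\<Sum>j\<le>k. B 0 j) - B 0 0)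
      + (-1) ^ k * (\<Sum>z\<in>{1..<r}. \<Sum>j\<le>k. B z j)"
    unfolding eq by (simp add: sum_distrib_left)
qed

section \<open>Specialisation to polynomials and the four parity cases\<close>

lemma q_var_power: "q_var ^ i = (monom 1 i :: complex poly)"
  by (simp add: monom_altdef)

theorem theorem2p3:
  fixes r n h k b :: nat and \<zeta> :: complex
  assumes "1 \<le> r" and "1 \<le> n"
    and "primitive_root_of_unity r \<zeta>"
    and "h < r"
    and "1 \<le> k" and "k \<le> n - 1"
    and "k + 1 \<le> b" and "b \<le> n" and "b mod 2 = n mod 2"
  shows "let U = uncolored [b - k..<b];
             V = uncolored [b - k + 1..<b + 1];
             GU = colored_perms_containing r n U;
             GV = colored_perms_containing r n V;
             \<chi> = char_1dim \<zeta> (-1) h;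
             q = q_var;
             tail = (\<lambda>m. \<Prod>i\<in>{m..n}. qbracket (i * r) (smult ((-1) ^ (i - 1) * \<zeta> ^ h) q))
         in
           (odd k \<longrightarrow>
              (even n \<longrightarrow>
                 fmaj_sum r \<chi> GU + fmaj_sum r \<chi> GV
                   = 2 * qbracket (k + 1) (- (q ^ r)) * tail (k + 2)) \<and>
              (odd n \<longrightarrow>
                 fmaj_sum r \<chi> GU + fmaj_sum r \<chi> GV
                   = 2 * qbracket (k + 1) (- (q ^ r)) * qbracket (k + 2) (q ^ r)
                       * qbracket r (smult (\<zeta> ^ h) q) * tail (k + 3))) \<and>
           (even k \<longrightarrow>
              (odd n \<longrightarrow>
                 fmaj_sum r \<chi> (GU - GV) + fmaj_sum r \<chi> (GV - GU)
                   = 2 * qbracket (k + 1) (- (q ^ r))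
                       * (qbracket r (smult (\<zeta> ^ h) q) - 1) * tail (k + 2)) \<and>
              (even n \<longrightarrow>
                 fmaj_sum r \<chi> (GU - GV) + fmaj_sum r \<chi> (GV - GU)
                   = 2 * f_factor \<zeta> h r * qbracket (k + 1) (q ^ r)
                       * qbracket (k + 2) (- (q ^ r)) * tail (k + 3)))"
proof -
  define p where "p = b - k"
  have b: "b = p + k" "1 \<le> p" "p + k \<le> n"
    using assms by (simp_all add: p_def)
  \<comment> \<open>As \<open>b = p + k\<close> has the parity of \<open>n\<close>, the parities of
    \<open>k\<close> and \<open>n\<close> decide whether the letter \<open>p - 1\<close> is left
    over.\<close>
  have parity: "even p \<longleftrightarrow> even (n + k)"
    using assms(9) unfolding b(1) by presburger
  have idx: "[b - k..<b] = [p..<p + k]" "[b - k + 1..<b + 1] = [Suc p..<Suc p + k]"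
    by (simp_all add: b(1) del: upt_Suc)
  define t where "t = smult (\<zeta> ^ h) q_var"
  have \<zeta>: "\<zeta> ^ r = 1" "\<zeta> \<noteq> 0"
    using assms(1,3) by (auto simp: primitive_root_of_unity_def power_0_left)
  have t_pow: "t ^ i = smult (\<zeta> ^ (h * i)) (q_var ^ i)" for i
    by (simp only: t_def smult_power power_mult)
  have t_r: "q_var ^ r = t ^ r"
    unfolding t_pow using \<zeta>(1) by (simp add: mult.commute[of h] power_mult)
  \<comment> \<open>The exponent has the shape of \<open>fmaj\<close>, with \<open>c\<close> for the
    color sum; \<zeta>^r = 1 removes the part \<open>r * m\<close>.\<close>
  have f_r: "(smult (\<zeta> ^ (h * c)) (q_var ^ (r * m + c)) :: complex poly) = t ^ (r * m + c)" for m c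
  proof -
    have "\<zeta> ^ (h * (r * m + c)) = (\<zeta> ^ r) ^ (h * m) * \<zeta> ^ (h * c)"
      unfolding power_mult[symmetric] power_add[symmetric] by (simp add: algebra_simps)
    then show ?thesis unfolding t_pow \<zeta>(1) by simp
  qed
  have sm: "smult ((-1) ^ i * \<zeta> ^ h) q_var = (-1) ^ i * t" for i
    by (cases "even i") (simp_all add: t_def)
  interpret non_torsion r t
  proof
    show "1 \<le> r" by fact
    fix i :: nat assume "0 < i"
    \<comment> \<open>A positive power of \<open>t\<close> has positive degree and so differs from
      1.\<close>
    have "degree (t ^ i) = i"
      unfolding t_pow q_var_power using \<zeta>(2) by (simp add: degree_monom_eq)
    with \<open>0 < i\<close> show "t ^ i \<noteq> 1" by auto
  qed
  let ?U = "uncolored [p..<p + k]" and ?V = "uncolored [Suc p..<Suc p + k]" and ?I = "{p..p + k}"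
  let ?BU = "insertions r (p + k) ?U" and ?BV = "insertions r p ?V"
  define S where "S = {1..n}"
  have S: "?I \<subseteq> S" "finite S" using b by (auto simp: S_def)
  have len: "length ?U = k" "length ?V = k"
    unfolding length_uncolored length_upt by simp_all
  have UV: "?U \<in> words r {p..<p + k}" "?V \<in> words r {Suc p..<Suc p + k}"
    by (rule uncolored_upt_in_words[OF assms(1)])+
  have I: "insert (p + k) {p..<p + k} = ?I" "insert p {Suc p..<Suc p + k} = ?I" by auto
  have fmaj_sum: "fmaj_sum r (char_1dim \<zeta> (-1) h) {w \<in> words r S. letters_in ?I w \<in> B} = wsum r t S ?I B" for B
    unfolding fmaj_sum_def wsum_def
  proof (rule sum.cong[OF refl])
    fix w
    have "smult (char_1dim \<zeta> (-1) h w) (q_var ^ fmaj r w)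
        = smult ((-1) ^ inversion_number (map fst w)) (t ^ fmaj r w)"
      unfolding fmaj_def f_r[symmetric] by (simp add: char_1dim_def abs_perm_def)
    then show "smult (char_1dim \<zeta> (-1) h w) (q_var ^ fmaj r w) = weight r t w"
      by (cases "even (inversion_number (map fst w))") (simp_all add: weight_def)
  qed
  have GU: "colored_perms_containing r n ?U = {w \<in> words r S. letters_in ?I w \<in> ?BU}"
    unfolding colored_perms_containing_def colored_perms_eq_words insertions_def S_def[symmetric]
    using words_containing[OF UV(1), of "p + k" S] S unfolding I by simp
  have GV: "colored_perms_containing r n ?V = {w \<in> words r S. letters_in ?I w \<in> ?BV}"
    unfolding colored_perms_containing_def colored_perms_eq_words insertions_def S_def[symmetric]
    using words_containing[OF UV(2), of p S] S unfolding I by simp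
  have Diff: "{w \<in> words r S. letters_in ?I w \<in> B} - {w \<in> words r S. letters_in ?I w \<in> C}
      = {w \<in> words r S. letters_in ?I w \<in> B - C}" for B C by auto
  define X where "X = (\<lambda>z j. wsum r t S ?I {inserted p z j ?V})"
  define X0 where "X0 = (\<Sum>j\<le>k. X 0 j)"
  define X1 where "X1 = (\<Sum>z\<in>{1..<r}. \<Sum>j\<le>k. X z j)"
  have sumU: "wsum r t S ?I ?BU = X 0 0 - (-1) ^ k * (X0 - X 0 0) + (-1) ^ k * X1"
    using wsum_insertions[OF UV(1) _ S(2), of "p + k" t ?I] sum_insertions_split(1)[OF S(1) assms(1), of t]
    unfolding len X0_def X1_def X_def by simp
  have sumV: "wsum r t S ?I ?BV = X0 + X1"
    using wsum_insertions[OF UV(2) _ S(2), of p t ?I] sum_insertions_split(2)[OF S(1) assms(1), of t]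
    unfolding len X0_def X1_def X_def by simp
  \<comment> \<open>For odd \<open>k\<close> the two sums are \<open>X0 - X1\<close> and
    \<open>X0 + X1\<close>.\<close>
  have oddk: "fmaj_sum r (char_1dim \<zeta> (-1) h) (colored_perms_containing r n ?U)
      + fmaj_sum r (char_1dim \<zeta> (-1) h) (colored_perms_containing r n ?V) = 2 * X0" if "odd k"
    unfolding GU GV fmaj_sum sumU sumV using that by simp
  \<comment> \<open>For even \<open>k\<close> the sums are \<open>2 * X 0 0 - X0 + X1\<close> and
    \<open>X0 + X1\<close>; removing the common increasing block, which contributes
    \<open>X 0 0\<close>, from each leaves \<open>2 * X1\<close> in total.\<close>
  have evenk: "fmaj_sum r (char_1dim \<zeta> (-1) h) (colored_perms_containing r n ?U - colored_perms_containing r n ?V)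
      + fmaj_sum r (char_1dim \<zeta> (-1) h) (colored_perms_containing r n ?V - colored_perms_containing r n ?U) = 2 * X1"
    if "even k"
  proof -
    have "2 \<le> k" using that assms(5) by (cases "k = 1") auto
    from insertions_Int[OF assms(1) this, of p] have "wsum r t S ?I (?BU \<inter> ?BV) = X 0 0"
      "wsum r t S ?I (?BV \<inter> ?BU) = X 0 0"
      unfolding X_def by (simp_all only: Int_commute)
    then show ?thesis
      unfolding GU GV Diff fmaj_sum wsum_Diff[OF S(2)] sumU sumV using that by simp
  qed
  have tail: "(\<Prod>i\<in>{m..n}. qbracket (i * r) (smult ((-1) ^ (i - 1) * \<zeta> ^ h) q_var))
      = (\<Prod>i\<in>{m..n}. bracket_factor r t i)" for m
    by (simp only: bracket_factor_def sm)
  have f: "f_factor \<zeta> h r = qbracket r (t ^ 2) - qbracket r t"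
    unfolding f_factor_def sm t_def[symmetric] by (rule qbracket_square_minus[symmetric])
  have odd_even: "2 * X0 = 2 * qbracket (k + 1) (- (t ^ r)) * (\<Prod>i\<in>{k + 2..n}. bracket_factor r t i)"
    if "odd k" "even n"
    using sum_wsum_inserted[of 0 p k n] b parity that assms(1)
    unfolding X0_def X_def S_def by (simp add: mult.assoc)
  have odd_odd: "2 * X0 = 2 * qbracket (k + 1) (- (t ^ r)) * qbracket (k + 2) (t ^ r) * qbracket r t
      * (\<Prod>i\<in>{k + 3..n}. bracket_factor r t i)"
    if "odd k" "odd n"
    using sum_wsum_inserted_unpaired_odd[of p k n] b parity that
    unfolding X0_def X_def S_def by (simp add: mult.assoc)
  have even_odd: "2 * X1 = 2 * qbracket (k + 1) (- (t ^ r)) * (qbracket r t - 1)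
      * (\<Prod>i\<in>{k + 2..n}. bracket_factor r t i)"
    if "even k" "odd n"
  proof -
    have "{..<r} = insert 0 {1..<r}" using assms(1) by auto
    \<comment> \<open>Subtracting 1 removes the color-zero term of the bracket.\<close>
    then have q: "qbracket r t - 1 = (\<Sum>z\<in>{1..<r}. t ^ z)" by (simp add: qbracket_def)
    have "X1 = (\<Sum>z\<in>{1..<r}. t ^ z * qbracket (k + 1) (- (t ^ r)) * (\<Prod>i\<in>{k + 2..n}. bracket_factor r t i))"
      unfolding X1_def X_def S_def using b parity that by (intro sum.cong refl sum_wsum_inserted) auto
    then have "X1 = qbracket (k + 1) (- (t ^ r)) * (qbracket r t - 1) * (\<Prod>i\<in>{k + 2..n}. bracket_factor r t i)"
      unfolding q by (simp only: sum_distrib_right sum_distrib_left mult.commute mult.left_commute)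
    then show ?thesis by (simp only: mult.assoc)
  qed
  have even_even: "2 * X1 = 2 * f_factor \<zeta> h r * qbracket (k + 1) (t ^ r) * qbracket (k + 2) (- (t ^ r))
      * (\<Prod>i\<in>{k + 3..n}. bracket_factor r t i)"
    if "even k" "even n"
    using sum_wsum_inserted_unpaired_even[of p k n] b parity that
    unfolding X1_def X_def S_def f by (simp only: mult.assoc) simp
  show ?thesis
    unfolding Let_def idx tail t_r t_def[symmetric]
    by (intro conjI impI)
      (rule trans[OF oddk odd_even] trans[OF oddk odd_odd]
        trans[OF evenk even_odd] trans[OF evenk even_even]; assumption)+
qed

end
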